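(* Let $U$ be an open subset of $D(0,T)$, where $Tg'(T)=2$. Then $$\limsup_{n\to\infty}\frac1{n^2}\log\mathbf P\big[\mathcal X_n^{(g)}(U)=0\big]\le -R_U^{(g)}-\liminf_{n\to\infty}\frac1{n^2}\log Z_n^{(g)}.$$
   Context: $m$ is Lebesgue measure on $\mathbb C$; $D(0,t)$ is the disk of radius $t$ centred at $0$; $U^c=\mathbb C\setminus U$. The function $g:[0,\infty)\to[0,\infty)$ satisfies: (a) $g$ is increasing and $re^{-g(r)/2}\to0$ as $r\to\infty$; (b) $g$ is twice differentiable on $(0,\infty)$; (c) $\lim_{r\to0^+}rg'(r)=0$ and $rg'(r)$ is increasing on $(0,\infty)$; (d) $\int_0^\infty r^{2k+1}e^{-g(r)}dr<\infty$ for all $k=0,1,2,\dots$. $T>0$ is the (unique) solution of $tg'(t)=2$. $\mathcal X_n^{(g)}$ is the determinantal point process of $n$ points in $\mathbb C$ whose vector of points (in uniform random order) has density $\frac1{Z_n^{(g)}}\prod_{i<j}|z_i-z_j|^2e^{-n\sum_{k=1}^ng(|z_k|)}$ with respect to Lebesgue measure on $\mathbb C^n$, where $Z_n^{(g)}=\int_{\mathbb C}\cdots\int_{\mathbb C}\prod_{i<j}|z_i-z_j|^2e^{-n\sum_{k=1}^ng(|z_k|)}\prod_{k=1}^ndm(z_k)$. $\mathcal X_n^{(g)}(\Omega)$ is the number of its points in $\Omega$. $\mathcal P(E)$ is the set of compactly supported probability measures with support in $E$. For $\mu\in\mathcal P(\mathbb C)$, $R_\mu^{(g)}=\iint\log\frac1{|z-w|}d\mu(z)d\mu(w)+\int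 g(|z|)d\mu(z)$, and $R_U^{(g)}=\inf\{R_\mu^{(g)}:\mu\in\mathcal P(U^c)\}$. *)

theory Defs
  imports "HOL-Probability.Probability"
begin

text \<open>Extended logarithm: \<open>ln 0 = 0\<close> in the library, whereas here \<open>log 0 = -\<infinity>\<close>.\<close>

definition log_ennreal :: "ennreal \<Rightarrow> ereal" where
  "log_ennreal x = (if x = 0 then - \<infinity> else if x = \<infinity> then \<infinity> else ereal (ln (enn2real x)))"

text \<open>
  Integral of an extended real function as positive part minus negative part
  (\<open>e2ennreal\<close> sends negative numbers to \<open>0\<close>); meaningful when one of the two parts is finite.
\<close>

definition ext_integral :: "'a measure \<Rightarrow> ('a \<Rightarrow> ereal) \<Rightarrow> ereal" where
  "ext_integral M f =
     enn2ereal (\<integral>\<^sup>+ x. e2ennreal (f x) \<partial>M) - enn2ereal (\<integral>\<^sup>+ x. e2ennreal (- f x) \<partial>M)"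

definition measure_support :: "'a::topological_space measure \<Rightarrow> 'a set" where
  "measure_support \<mu> = {x. \<forall>V. open V \<and> x \<in> V \<longrightarrow> emeasure \<mu> V > 0}"

definition compact_prob_measures :: "complex set \<Rightarrow> complex measure set" where
  "compact_prob_measures E =
     {\<mu>. prob_space \<mu> \<and> sets \<mu> = sets borel \<and>
         compact (measure_support \<mu>) \<and> measure_support \<mu> \<subseteq> E}"

text \<open>
  The kernel \<open>log (1 / |z - w|)\<close> is \<open>\<infinity>\<close> on the diagonal, so measures with atoms have infinite
  energy. For compactly supported \<open>\<mu>\<close> and \<open>g \<ge> 0\<close> both terms below are \<open>> -\<infinity>\<close>.
\<close>

definition weighted_energy :: "(real \<Rightarrow> real) \<Rightarrow> complex measure \<Rightarrow> ereal" where
  "weighted_energy g \<mu> =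
     ext_integral (\<mu> \<Otimes>\<^sub>M \<mu>) (\<lambda>(z, w). - log_ennreal (ennreal (cmod (z - w)))) +
     ext_integral \<mu> (\<lambda>z. ereal (g (cmod z)))"

definition hole_energy :: "(real \<Rightarrow> real) \<Rightarrow> complex set \<Rightarrow> ereal" where
  "hole_energy g U = (INF \<mu> \<in> compact_prob_measures (- U). weighted_energy g \<mu>)"

text \<open>
  A point of \<open>\<complex>\<^sup>n\<close> is a function on \<open>{..<n}\<close>, and Lebesgue measure on \<open>\<complex>\<^sup>n\<close> is the
  \<open>n\<close>-fold product of \<^term>\<open>lborel :: complex measure\<close>.
\<close>

definition gas_weight :: "(real \<Rightarrow> real) \<Rightarrow> nat \<Rightarrow> (nat \<Rightarrow> complex) \<Rightarrow> real" where
  "gas_weight g n z =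
     (\<Prod>j<n. \<Prod>i<j. (cmod (z i - z j))\<^sup>2) * exp (- real n * (\<Sum>k<n. g (cmod (z k))))"

definition gas_partition :: "(real \<Rightarrow> real) \<Rightarrow> nat \<Rightarrow> ennreal" where
  "gas_partition g n =
     (\<integral>\<^sup>+ z. ennreal (gas_weight g n z) \<partial>(\<Pi>\<^sub>M k\<in>{..<n}. (lborel :: complex measure)))"

text \<open>
  The joint law of the points of the process, listed in uniform random order; it determines the
  process, whose number of points in a set is \<open>point_count\<close>.
\<close>

definition gas_law :: "(real \<Rightarrow> real) \<Rightarrow> nat \<Rightarrow> (nat \<Rightarrow> complex) measure" where
  "gas_law g n =
     density (\<Pi>\<^sub>M k\<in>{..<n}. (lborel :: complex measure))
       (\<lambda>z. ennreal (gas_weight g n z) / gas_partition g n)"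

definition point_count :: "nat \<Rightarrow> (nat \<Rightarrow> complex) \<Rightarrow> complex set \<Rightarrow> nat" where
  "point_count n z \<Omega> = card {k \<in> {..<n}. z k \<in> \<Omega>}"

definition hole_prob :: "(real \<Rightarrow> real) \<Rightarrow> nat \<Rightarrow> complex set \<Rightarrow> ennreal" where
  "hole_prob g n U = emeasure (gas_law g n) {z \<in> space (gas_law g n). point_count n z U = 0}"

end

theory Submission
  imports Defs
begin

text \<open>
  On configurations of distinct points the weight factors as
  \<open>gas_weight g n z = exp (- E z) * (\<Prod>k<n. exp (- g \<bar>z\<^sub>k\<bar>))\<close>, where
  \<open>E z\<close> is the sum over ordered pairs \<open>i \<noteq> j\<close> of the weighted kernel
  \<open>g \<bar>z\<^sub>i\<bar> / 2 + g \<bar>z\<^sub>j\<bar> / 2 - log \<bar>z\<^sub>i - z\<^sub>j\<bar>\<close>. By the moment hypothesis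
  \<open>exp (- g \<bar>z\<bar>)\<close> has a finite integral over the plane, so the second factor contributes only
  \<open>c\<^sup>n\<close>, which disappears after division by \<open>n\<^sup>2\<close>. It remains to bound the energy of the
  configurations that avoid \<open>U\<close> (lemma \<open>eventually_pair_energy_greater\<close>): for every real
  \<open>A < hole_energy g U\<close> and all large \<open>n\<close>, each of them satisfies \<open>E z > A n\<^sup>2\<close>.

  Suppose this fails for infinitely many \<open>n\<close>. The kernel is at least the sum of the two values of
  \<open>g r / 2 - log (1 + r)\<close>, a function that is bounded below and tends to infinity, so all but a
  small proportion of the points lie in a fixed disc (lemma \<open>low_energy_configuration\<close>). The
  empirical measures of the remaining points live on one compact set disjoint from \<open>U\<close>. Along a
  subsequence they converge weakly, and since the kernel with truncated logarithm is bounded and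
  lower semicontinuous on that set, the limit measure has energy less than \<open>hole_energy g U\<close>
  (lemma \<open>limit_measure_energy_le\<close>), a contradiction.

  Compactness of measures in the plane is reduced to Helly's theorem on the line: the points of
  a bounded set are lifted to parameters in \<open>[0, 1]\<close> of a space-filling curve. Skorohod's theorem,
  applied to the laws of the parameters, even gives random points with the prescribed laws that
  converge pointwise (lemma \<open>bounded_pmf_sequence_skorohod\<close>), so that limits of double integrals
  follow by dominated convergence.
\<close>

section \<open>A space-filling curve\<close>

text \<open>
  Schoenberg's construction of a space-filling curve uses a continuous function of period \<open>2\<close> that
  vanishes on \<open>[0, 1/3]\<close> and equals \<open>1\<close> on \<open>[2/3, 1]\<close>; here it is a cosine cut off at \<open>0\<close> and \<open>1\<close>.
\<close>

definition schoenberg_bump :: "real \<Rightarrow> real" where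
  "schoenberg_bump s = max 0 (min 1 (1/2 - cos (pi * s)))"

text \<open>
  The coordinates of the curve are the functions with \<open>r = 0\<close> and \<open>r = 1\<close>. If the ternary digits
  of \<open>t\<close> are \<open>2 a\<^sub>0, 2 a\<^sub>1, \<dots>\<close> with \<open>a\<^sub>k \<in> {0, 1}\<close>, then the binary digits of the coordinates are
  the \<open>a\<^sub>k\<close> with \<open>k\<close> even and with \<open>k\<close> odd, respectively.
\<close>

definition schoenberg_coord :: "nat \<Rightarrow> real \<Rightarrow> real" where
  "schoenberg_coord r t = (\<Sum>k. schoenberg_bump (3 ^ (2 * k + r) * t) / 2 ^ Suc k)"

lemma continuous_on_schoenberg_bump: "continuous_on A schoenberg_bump"
  unfolding schoenberg_bump_def by (intro continuous_intros)

lemma schoenberg_bump_shift: "schoenberg_bump (2 * of_int N + u) = schoenberg_bump u"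
proof -
  have "cos (pi * (2 * of_int N + u)) = cos (pi * u)"
    using cos_int_2pin[of N] sin_int_2pin[of N]
    by (simp add: ring_distribs cos_add mult_ac)
  then show ?thesis by (simp add: schoenberg_bump_def)
qed

lemma schoenberg_bump_eq_0:
  assumes "0 \<le> u" "u \<le> 1/3" shows "schoenberg_bump u = 0"
proof -
  have "cos (pi / 3) \<le> cos (pi * u)"
    using assms by (intro cos_monotone_0_pi_le) auto
  then show ?thesis by (simp add: schoenberg_bump_def cos_60)
qed

lemma schoenberg_bump_eq_1:
  assumes "2/3 \<le> u" "u \<le> 1" shows "schoenberg_bump u = 1"
proof -
  have "cos (pi * u) \<le> cos (2 / 3 * pi)"
    using assms by (intro cos_monotone_0_pi_le) auto
  also have "\<dots> = - cos (pi / 3)"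
    using cos_minus_pi[of "pi/3"] cos_minus[of "pi / 3 - pi"] by (simp add: field_simps)
  finally show ?thesis by (simp add: schoenberg_bump_def cos_60)
qed

lemma continuous_on_schoenberg_coord: "continuous_on UNIV (schoenberg_coord r)"
proof -
  have bnd: "norm (schoenberg_bump (3 ^ (2 * k + r) * t) / 2 ^ Suc k) \<le> (1/2) ^ Suc k" for k t
    by (auto simp: schoenberg_bump_def power_one_over divide_simps)
  have "summable (\<lambda>k. (1/2::real) ^ Suc k)"
    by (simp add: summable_geometric summable_Suc_iff)
  with bnd have "uniform_limit UNIV (\<lambda>n t. \<Sum>k<n. schoenberg_bump (3 ^ (2 * k + r) * t) / 2 ^ Suc k)
      (schoenberg_coord r) sequentially"
    unfolding schoenberg_coord_def by (intro Weierstrass_m_test)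
  moreover have "continuous_on UNIV (\<lambda>t. \<Sum>k<n. schoenberg_bump (3 ^ (2 * k + r) * t) / 2 ^ Suc k)" for n
    by (intro continuous_intros continuous_on_compose2[OF continuous_on_schoenberg_bump[of UNIV]]) auto
  ultimately show ?thesis
    by (intro uniform_limit_theorem[where F = sequentially]) auto
qed

lemma binary_expansion:
  fixes x :: real
  assumes "0 \<le> x" "x < 1"
  obtains a :: "nat \<Rightarrow> int" where "\<And>k. a k = 0 \<or> a k = 1" "(\<lambda>k. of_int (a k) / 2 ^ Suc k) sums x"
proof
  define a where "a k = \<lfloor>2 ^ Suc k * x\<rfloor> mod 2" for k
  show "a k = 0 \<or> a k = 1" for k unfolding a_def by presburger
  have part: "(\<Sum>k<n. of_int (a k) / 2 ^ Suc k) = of_int \<lfloor>2 ^ n * x\<rfloor> / (2 ^ n :: real)" for n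
  proof (induction n)
    case 0
    show ?case using assms by (simp add: floor_eq_iff)
  next
    case (Suc n)
    have "\<lfloor>2 ^ n * x\<rfloor> = \<lfloor>2 ^ Suc n * x\<rfloor> div 2"
      using floor_divide_real_eq_div[of 2 "2 ^ Suc n * x"] by simp
    then have "\<lfloor>2 ^ Suc n * x\<rfloor> = 2 * \<lfloor>2 ^ n * x\<rfloor> + a n"
      unfolding a_def by presburger
    then have "real_of_int \<lfloor>2 ^ Suc n * x\<rfloor> = 2 * of_int \<lfloor>2 ^ n * x\<rfloor> + of_int (a n)" by simp
    then show ?case unfolding sum.lessThan_Suc Suc.IH by (simp add: field_simps)
  qed
  have "(\<lambda>n. of_int \<lfloor>2 ^ n * x\<rfloor> / (2 ^ n :: real)) \<longlonglongrightarrow> x"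
  proof (rule LIMSEQ_I)
    fix e :: real assume "0 < e"
    then obtain N where N: "(1/2::real) ^ N < e" using real_arch_pow_inv[of e "1/2"] by auto
    have "norm (of_int \<lfloor>2 ^ n * x\<rfloor> / 2 ^ n - x) < e" if "N \<le> n" for n
    proof -
      have "norm (of_int \<lfloor>2 ^ n * x\<rfloor> / 2 ^ n - x) = \<bar>of_int \<lfloor>2 ^ n * x\<rfloor> - 2 ^ n * x\<bar> / 2 ^ n"
        by (simp add: field_simps abs_divide[symmetric] del: abs_divide)
      also have "\<dots> \<le> 1 / 2 ^ n"
        by (intro divide_right_mono zero_le_power) linarith+
      also have "\<dots> \<le> (1/2) ^ N" using that by (simp add: power_one_over field_simps)
      finally show ?thesis using N by simp
    qed
    then show "\<exists>N. \<forall>n\<ge>N. norm (of_int \<lfloor>2 ^ n * x\<rfloor> / 2 ^ n - x) < e" by blast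
  qed
  then show "(\<lambda>k. of_int (a k) / 2 ^ Suc k) sums x"
    unfolding sums_def part .
qed

lemma schoenberg_surj:
  fixes x y :: real
  assumes "0 \<le> x" "x < 1" "0 \<le> y" "y < 1"
  obtains t where "t \<in> {0..1}" "schoenberg_coord 0 t = x" "schoenberg_coord 1 t = y"
proof -
  obtain b where b: "\<And>k. b k = 0 \<or> b k = 1" "(\<lambda>k. of_int (b k :: int) / 2 ^ Suc k) sums x"
    using binary_expansion assms by blast
  obtain c where c: "\<And>k. c k = 0 \<or> c k = 1" "(\<lambda>k. of_int (c k :: int) / 2 ^ Suc k) sums y"
    using binary_expansion assms by blast
  \<comment> \<open>The digits of the two coordinates, interleaved.\<close>
  define a where "a k = (if even k then b (k div 2) else c (k div 2))" for k :: nat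
  have a01: "a k = 0 \<or> a k = 1" for k unfolding a_def using b(1) c(1) by auto
  \<comment> \<open>It will turn out that \<open>3 ^ k * u 0\<close> and \<open>u k\<close> differ by an even integer.\<close>
  define u where "u k = (\<Sum>j. 2 * of_int (a (k + j)) / (3::real) ^ Suc j)" for k
  have sm: "summable (\<lambda>j. 2 * of_int (a (k + j)) / (3::real) ^ Suc j)" for k
  proof (rule summable_comparison_test')
    show "summable (\<lambda>j. 2 * (1/3::real) ^ Suc j)"
      by (simp add: summable_geometric summable_Suc_iff summable_mult)
    show "norm (2 * of_int (a (k + j)) / (3::real) ^ Suc j) \<le> 2 * (1/3) ^ Suc j" if "0 \<le> j" for j
      using a01[of "k + j"] by (auto simp: power_one_over field_simps)
  qed
  have u0: "0 \<le> u k" for k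
    unfolding u_def using a01 by (intro suminf_nonneg sm) (metis (no_types, lifting) divide_nonneg_nonneg mult_nonneg_nonneg of_int_0_le_iff zero_le_numeral zero_le_power zero_le_one order_refl)
  have u1: "u k \<le> 1" for k
  proof -
    have g: "(\<lambda>j. (2/3) * (1/3::real) ^ j) sums ((2/3) * (1 / (1 - 1/3)))"
      by (intro sums_mult geometric_sums) auto
    have "u k \<le> (\<Sum>j. (2/3) * (1/3::real) ^ j)"
      unfolding u_def
    proof (intro suminf_le sm)
      show "summable (\<lambda>j. (2/3) * (1/3::real) ^ j)" using g by (rule sums_summable)
      show "2 * of_int (a (k + j)) / 3 ^ Suc j \<le> (2/3) * (1/3::real) ^ j" for j
        using a01[of "k + j"] by (auto simp: power_one_over field_simps)
    qed
    also have "\<dots> = 1" using sums_unique[OF g] by simp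
    finally show ?thesis .
  qed
  have rec: "3 * u k = 2 * of_int (a k) + u (Suc k)" for k
  proof -
    have "u k = 2 * of_int (a (k + 0)) / 3 ^ Suc 0 + (\<Sum>j. 2 * of_int (a (k + Suc j)) / (3::real) ^ Suc (Suc j))"
      using suminf_split_head[OF sm[of k]] unfolding u_def by simp
    also have "(\<Sum>j. 2 * of_int (a (k + Suc j)) / (3::real) ^ Suc (Suc j)) = (\<Sum>j. (1/3) * (2 * of_int (a (Suc k + j)) / (3::real) ^ Suc j))"
      by (intro suminf_cong) simp
    also have "\<dots> = (1/3) * u (Suc k)"
      unfolding u_def by (intro suminf_mult sm)
    finally show ?thesis by simp
  qed
  have shift: "\<exists>N::int. 3 ^ k * u 0 = 2 * of_int N + u k" for k
  proof (induction k)
    case 0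
    show ?case by (intro exI[of _ 0]) simp
  next
    case (Suc k)
    then obtain N :: int where N: "3 ^ k * u 0 = 2 * of_int N + u k" by blast
    show ?case
      using rec[of k] N by (intro exI[of _ "3 * N + a k"]) simp
  qed
  have bump: "schoenberg_bump (3 ^ k * u 0) = of_int (a k)" for k
  proof -
    obtain N :: int where "3 ^ k * u 0 = 2 * of_int N + u k" using shift by blast
    then have "schoenberg_bump (3 ^ k * u 0) = schoenberg_bump (u k)"
      by (simp add: schoenberg_bump_shift)
    also have "\<dots> = of_int (a k)"
      using a01[of k] rec[of k] u0[of k] u1[of k] u0[of "Suc k"] u1[of "Suc k"]
      by (auto simp: schoenberg_bump_eq_0 schoenberg_bump_eq_1)
    finally show ?thesis .
  qed
  have "schoenberg_coord 0 (u 0) = x" "schoenberg_coord 1 (u 0) = y"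
    using sums_unique[OF b(2)] sums_unique[OF c(2)]
    unfolding schoenberg_coord_def bump by (simp_all add: a_def)
  with u0[of 0] u1[of 0] show ?thesis using that[of "u 0"] by auto
qed

lemma continuous_curve_covering_bounded_set:
  fixes K :: "complex set"
  assumes "bounded K"
  obtains \<phi> :: "real \<Rightarrow> complex" where "continuous_on UNIV \<phi>" "K \<subseteq> \<phi> ` {0..1}"
proof -
  obtain R where R: "0 < R" "\<And>z. z \<in> K \<Longrightarrow> cmod z < R"
    using assms by (meson bounded_normE_less)
  define \<phi> where "\<phi> t = Complex (2 * R * schoenberg_coord 0 t - R) (2 * R * schoenberg_coord 1 t - R)" for t
  show ?thesis
  proof
    show "continuous_on UNIV \<phi>"
      unfolding \<phi>_def Complex_eq
      by (intro continuous_intros continuous_on_schoenberg_coord)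
    show "K \<subseteq> \<phi> ` {0..1}"
    proof
      fix z assume "z \<in> K"
      then have "\<bar>Re z\<bar> < R" "\<bar>Im z\<bar> < R"
        using R(2)[of z] abs_Re_le_cmod[of z] abs_Im_le_cmod[of z] by linarith+
      then have "0 \<le> (Re z + R) / (2 * R)" "(Re z + R) / (2 * R) < 1"
          "0 \<le> (Im z + R) / (2 * R)" "(Im z + R) / (2 * R) < 1"
        using R(1) by (auto simp: field_simps)
      then obtain t where "t \<in> {0..1}" "schoenberg_coord 0 t = (Re z + R) / (2 * R)"
        "schoenberg_coord 1 t = (Im z + R) / (2 * R)"
        using schoenberg_surj by metis
      then have "\<phi> t = z" using R(1) by (simp add: \<phi>_def complex_eq_iff)
      with \<open>t \<in> {0..1}\<close> show "z \<in> \<phi> ` {0..1}" by blast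
    qed
  qed
qed

section \<open>Compactness of planar discrete laws\<close>

text \<open>
  Sequential compactness of discrete probability measures on a bounded planar set, in the form of
  pointwise convergent random variables.
\<close>

lemma bounded_pmf_sequence_skorohod:
  fixes p :: "nat \<Rightarrow> complex pmf"
  assumes "bounded K" "\<And>n. set_pmf (p n) \<subseteq> K"
  obtains s :: "nat \<Rightarrow> nat" and \<Omega> :: "real measure" and X :: "nat \<Rightarrow> real \<Rightarrow> complex" and Y
  where "strict_mono s" "prob_space \<Omega>" "\<And>n. X n \<in> borel_measurable \<Omega>" "Y \<in> borel_measurable \<Omega>"
    "\<And>n. distr \<Omega> borel (X n) = distr (measure_pmf (p (s n))) borel id"
    "\<And>\<omega>. \<omega> \<in> space \<Omega> \<Longrightarrow> (\<lambda>n. X n \<omega>) \<longlonglongrightarrow> Y \<omega>"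
proof -
  obtain \<phi> :: "real \<Rightarrow> complex" where \<phi>: "continuous_on UNIV \<phi>" "K \<subseteq> \<phi> ` {0..1}"
    using continuous_curve_covering_bounded_set[OF assms(1)] .
  have [measurable]: "\<phi> \<in> borel_measurable borel" using \<phi>(1) by (rule borel_measurable_continuous_onI)
  \<comment> \<open>A right inverse of the curve; it need not be measurable, since it is applied to discrete laws only.\<close>
  define \<psi> where "\<psi> = inv_into {0..1} \<phi>"
  have \<psi>: "\<psi> z \<in> {0..1}" "\<phi> (\<psi> z) = z" if "z \<in> K" for z
    using that \<phi>(2) inv_into_into[of z \<phi> "{0..1}"] unfolding \<psi>_def by (auto simp: f_inv_into_f)
  define \<nu> where "\<nu> n = distr (measure_pmf (p n)) borel \<psi>" for n
  have dist: "real_distribution (\<nu> n)" for n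
    unfolding \<nu>_def real_distribution_def real_distribution_axioms_def
    by (auto intro!: measure_pmf.prob_space_distr)
  have "tight \<nu>"
    unfolding tight_def
  proof (intro conjI allI impI dist)
    fix e :: real assume "0 < e"
    have "measure (\<nu> n) {-1<..1} = 1" for n
    proof -
      have "measure (\<nu> n) {-1<..1} = measure (measure_pmf (p n)) (\<psi> -` {-1<..1})"
        by (simp add: \<nu>_def measure_distr)
      also have "\<dots> = 1"
      proof (subst measure_pmf.prob_eq_1, simp, rule AE_pmfI)
        fix z assume "z \<in> set_pmf (p n)"
        then show "z \<in> \<psi> -` {-1<..1}" using \<psi>(1)[of z] assms(2)[of n] by auto
      qed
      finally show ?thesis .
    qed
    then show "\<exists>a b. a < b \<and> (\<forall>n. 1 - e < measure (\<nu> n) {a<..b})"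
      using \<open>0 < e\<close> by (intro exI[of _ "-1"] exI[of _ 1]) auto
  qed
  from tight_imp_convergent_subsubsequence[OF this, of id]
  obtain r M where r: "strict_mono (r :: nat \<Rightarrow> nat)" "real_distribution M" "weak_conv_m (\<nu> \<circ> r) M"
    by (auto simp: strict_mono_id)
  have "\<exists>(\<Omega> :: real measure) Ys Y. prob_space \<Omega> \<and> (\<forall>n. Ys n \<in> borel_measurable \<Omega>) \<and>
      (\<forall>n. distr \<Omega> borel (Ys n) = (\<nu> \<circ> r) n) \<and> Y \<in> measurable \<Omega> lborel \<and> distr \<Omega> borel Y = M \<and>
      (\<forall>x\<in>space \<Omega>. (\<lambda>n. Ys n x) \<longlonglongrightarrow> Y x)"
    by (rule Skorohod[OF _ r(2,3)]) (simp add: dist)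
  then obtain \<Omega> Ys Y where sk: "prob_space (\<Omega> :: real measure)" "\<And>n. Ys n \<in> borel_measurable \<Omega>"
      "\<And>n. distr \<Omega> borel (Ys n) = (\<nu> \<circ> r) n" "Y \<in> measurable \<Omega> lborel"
      "\<And>x. x \<in> space \<Omega> \<Longrightarrow> (\<lambda>n. Ys n x) \<longlonglongrightarrow> Y x"
    by blast
  have [measurable]: "Y \<in> borel_measurable \<Omega>" using sk(4) by simp
  note [measurable] = sk(2)
  show ?thesis
  proof (rule that[of r \<Omega> "\<lambda>n \<omega>. \<phi> (Ys n \<omega>)" "\<lambda>\<omega>. \<phi> (Y \<omega>)"])
    fix n
    have "distr \<Omega> borel (\<lambda>\<omega>. \<phi> (Ys n \<omega>)) = distr (distr \<Omega> borel (Ys n)) borel \<phi>"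
      by (subst distr_distr) (auto simp: comp_def)
    also have "\<dots> = distr (measure_pmf (p (r n))) borel (\<lambda>z. \<phi> (\<psi> z))"
      unfolding sk(3) by (simp add: \<nu>_def distr_distr comp_def)
    also have "\<dots> = distr (measure_pmf (p (r n))) borel id"
      using \<psi>(2) assms(2) by (intro distr_cong_AE) (auto intro!: AE_pmfI simp: subset_iff)
    finally show "distr \<Omega> borel (\<lambda>\<omega>. \<phi> (Ys n \<omega>)) = distr (measure_pmf (p (r n))) borel id" .
  next
    fix \<omega> assume "\<omega> \<in> space \<Omega>"
    then show "(\<lambda>n. \<phi> (Ys n \<omega>)) \<longlonglongrightarrow> \<phi> (Y \<omega>)"
      using sk(5) \<phi>(1) by (auto intro!: continuous_on_tendsto_compose[of UNIV \<phi>])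
  qed (use r sk in auto)
qed

section \<open>Integrability of the radial weight\<close>

lemma emeasure_ball_complex_le: "emeasure lborel (ball (0::complex) r) \<le> ennreal (4 * r\<^sup>2)"
proof (cases "r \<ge> 0")
  case True
  have "pi * r\<^sup>2 \<le> 4 * r\<^sup>2" using pi_less_4 by (intro mult_right_mono) auto
  then show ?thesis using emeasure_ball[OF True, of "0::complex"]
    by (simp add: unit_ball_vol_2 ennreal_leI)
next
  case False
  then have "ball (0::complex) r = {}" by (intro ball_empty) simp
  then show ?thesis by (simp only: emeasure_empty zero_le)
qed

lemma measurable_radial:
  fixes g :: "real \<Rightarrow> real"
  assumes "mono_on {0..} g"
  shows "(\<lambda>z :: complex. g (cmod z)) \<in> borel_measurable borel"
proof -
  have "mono (\<lambda>r. g (max 0 r))"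
    using assms by (auto simp: mono_def mono_on_def max_def)
  then have [measurable]: "(\<lambda>r. g (max 0 r)) \<in> borel_measurable borel" by (rule borel_measurable_mono)
  have "(\<lambda>z :: complex. g (max 0 (cmod z))) \<in> borel_measurable borel" by measurable
  then show ?thesis by simp
qed

text \<open>
  Monotonicity of \<open>g\<close> turns the third moment into the pointwise bound \<open>exp (- g r) = O(r ^ (- 4))\<close>,
  which is integrable over the plane.
\<close>

lemma nn_integral_radial_weight_finite:
  fixes g :: "real \<Rightarrow> real"
  assumes g_mono: "mono_on {0..} g"
    and g_nonneg: "\<And>r. 0 \<le> r \<Longrightarrow> 0 \<le> g r"
    and moment: "set_integrable lborel {0..} (\<lambda>r. r ^ 3 * exp (- g r))"
  shows "(\<integral>\<^sup>+ z. ennreal (exp (- g (cmod z))) \<partial>(lborel :: complex measure)) < \<infinity>"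
proof -
  define I where "I = (LINT r:{0..}|lborel. r ^ 3 * exp (- g r))"
  have decay: "r ^ 4 * exp (- g r) \<le> 16 * I" if "0 \<le> r" for r
  proof -
    have sub: "set_integrable lborel {r/2..r} (\<lambda>r. r ^ 3 * exp (- g r))"
      using that by (intro set_integrable_subset[OF moment]) auto
    have "r ^ 4 * exp (- g r) / 16 = (LINT s:{r/2..r}|lborel. (r/2) ^ 3 * exp (- g r))"
      using that by (simp add: set_lebesgue_integral_def power3_eq_cube power4_eq_xxxx)
    also have "\<dots> \<le> (LINT s:{r/2..r}|lborel. s ^ 3 * exp (- g s))"
    proof (rule set_integral_mono[OF _ sub])
      show "set_integrable lborel {r / 2..r} (\<lambda>s. (r / 2) ^ 3 * exp (- g r))"
        unfolding set_integrable_def by (rule borel_integrable_compact) (rule compact_Icc, rule continuous_on_const)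
      show "(r / 2) ^ 3 * exp (- g r) \<le> s ^ 3 * exp (- g s)" if "s \<in> {r/2..r}" for s
        using that \<open>0 \<le> r\<close> g_mono by (intro mult_mono power_mono) (auto simp: mono_on_def)
    qed
    also have "\<dots> \<le> I"
      unfolding I_def set_lebesgue_integral_def
      using that moment sub
      by (intro integral_mono) (auto simp: set_integrable_def split: split_indicator)
    finally show ?thesis by simp
  qed
  have I0: "0 \<le> I" using decay[of 0] by simp
  define C where "C = 16 * (1 + 16 * I)"
  have C0: "0 < C" using I0 by (simp add: C_def)
  have bnd: "exp (- g r) \<le> C / real (Suc n) ^ 4" if "real n \<le> r" for n r
  proof (cases n)
    case 0
    then have "exp (- g r) \<le> 1" using that g_nonneg[of r] by simp
    also have "1 \<le> C" using I0 by (simp add: C_def)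
    finally show ?thesis using 0 by simp
  next
    case (Suc m)
    then have r: "1 \<le> real n" "0 \<le> r" using that by auto
    have "real (Suc n) ^ 4 * exp (- g r) \<le> (2 * r) ^ 4 * exp (- g r)"
      using r that by (intro mult_right_mono power_mono) auto
    also have "\<dots> \<le> C" using decay[of r] r I0 by (simp add: C_def power_mult_distrib)
    finally show ?thesis by (simp add: field_simps)
  qed
  have "(\<integral>\<^sup>+ z. ennreal (exp (- g (cmod z))) \<partial>(lborel :: complex measure))
     \<le> (\<integral>\<^sup>+ z. (\<Sum>n. ennreal (C / real (Suc n) ^ 4) * indicator (ball 0 (real (Suc n))) z) \<partial>(lborel :: complex measure))"
  proof (rule nn_integral_mono)
    fix z :: complex
    have single: "u n \<le> (\<Sum>n. u n)" for u :: "nat \<Rightarrow> ennreal" and n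
      using sum_le_suminf[of u "{n}"] by simp
    define n where "n = nat \<lfloor>cmod z\<rfloor>"
    have n: "real n \<le> cmod z" "cmod z < real (Suc n)" unfolding n_def using norm_ge_zero[of z] by linarith+
    have "ennreal (exp (- g (cmod z))) \<le> ennreal (C / real (Suc n) ^ 4) * indicator (ball 0 (real (Suc n))) z"
      using bnd[OF n(1)] n(2) by (simp add: ennreal_leI)
    also have "\<dots> \<le> (\<Sum>n. ennreal (C / real (Suc n) ^ 4) * indicator (ball 0 (real (Suc n))) z)"
      using single[of "\<lambda>n. ennreal (C / real (Suc n) ^ 4) * indicator (ball 0 (real (Suc n))) z" n] .
    finally show "ennreal (exp (- g (cmod z))) \<le> \<dots>" .
  qed
  also have "\<dots> = (\<Sum>n. ennreal (C / real (Suc n) ^ 4) * emeasure lborel (ball (0::complex) (real (Suc n))))"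
  proof (subst nn_integral_suminf)
    show "(\<lambda>z. ennreal (C / real (Suc i) ^ 4) * indicator (ball (0::complex) (real (Suc i))) z)
        \<in> borel_measurable lborel" for i
      by (intro borel_measurable_times_ennreal borel_measurable_const borel_measurable_indicator) simp
  qed (intro suminf_cong nn_integral_cmult_indicator, simp)
  also have "\<dots> \<le> (\<Sum>n. ennreal (4 * C * (1 / real (Suc n) ^ 2)))"
  proof (intro suminf_le)
    fix n
    have "ennreal (C / real (Suc n) ^ 4) * emeasure lborel (ball (0::complex) (real (Suc n)))
       \<le> ennreal (C / real (Suc n) ^ 4) * ennreal (4 * (real (Suc n))\<^sup>2)"
      by (intro mult_left_mono emeasure_ball_complex_le) auto
    also have "\<dots> = ennreal (C / real (Suc n) ^ 4 * (4 * (real (Suc n))\<^sup>2))"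
      using C0 by (intro ennreal_mult[symmetric]) auto
    also have "C / real (Suc n) ^ 4 * (4 * (real (Suc n))\<^sup>2) = 4 * C * (1 / real (Suc n) ^ 2)"
      by (simp add: field_simps power2_eq_square power4_eq_xxxx del: of_nat_Suc)
    finally show "ennreal (C / real (Suc n) ^ 4) * emeasure lborel (ball (0::complex) (real (Suc n)))
      \<le> ennreal (4 * C * (1 / real (Suc n) ^ 2))" .
  qed auto
  also have "\<dots> < \<infinity>"
  proof -
    have "summable (\<lambda>n. 1 / real (Suc n) ^ 2)"
      using inverse_power_summable[of 2, where 'a = real] by (subst summable_Suc_iff) (simp add: divide_inverse)
    then have "summable (\<lambda>n. 4 * C * (1 / real (Suc n) ^ 2))" by (rule summable_mult)
    then have "(\<Sum>n. ennreal (4 * C * (1 / real (Suc n) ^ 2))) = ennreal (\<Sum>n. 4 * C * (1 / real (Suc n) ^ 2))"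
      using C0 by (intro suminf_ennreal2) auto
    then show ?thesis by simp
  qed
  finally show ?thesis .
qed

section \<open>Energy of limit measures\<close>

text \<open>
  The kernel \<open>log (1 / \<bar>z - w\<bar>)\<close> cut off at the level \<open>M\<close> near the diagonal; distances above \<open>b\<close> are
  also cut off, which makes it a bounded continuous function on the whole plane. On a set of
  diameter at most \<open>b\<close> only the first cut-off matters.
\<close>

definition trunc_log :: "real \<Rightarrow> real \<Rightarrow> complex \<Rightarrow> complex \<Rightarrow> real" where
  "trunc_log M b z w = - ln (max (exp (- M)) (min b (cmod (z - w))))"

lemma continuous_trunc_log: "continuous_on UNIV (\<lambda>x. trunc_log M b (fst x) (snd x))"
proof -
  have "max (exp (- M)) t \<noteq> 0" for t :: real using exp_gt_zero[of "-M"] by (auto simp: max_def split: if_splits)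
  then show ?thesis unfolding trunc_log_def by (intro continuous_intros) auto
qed

lemma trunc_log_measurable [measurable (raw)]:
  assumes [measurable]: "f \<in> borel_measurable N" "h \<in> borel_measurable N"
  shows "(\<lambda>x. trunc_log M b (f x) (h x)) \<in> borel_measurable N"
  unfolding trunc_log_def by measurable

lemma abs_trunc_log_le:
  assumes "1 \<le> b" "0 \<le> M"
  shows "\<bar>trunc_log M b z w\<bar> \<le> M + ln b"
proof -
  define t where "t = max (exp (- M)) (min b (cmod (z - w)))"
  have "exp (- M) \<le> 1" using assms by simp
  then have t: "exp (- M) \<le> t" "t \<le> b" using assms(1) unfolding t_def by linarith+
  have t0: "0 < t" using t(1) exp_gt_zero[of "-M"] by linarith
  have "ln t \<le> ln b" using t t0 assms by simp
  moreover have "- M \<le> ln t" using t t0 by (simp add: ln_ge_iff)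
  moreover have "0 \<le> ln b" using assms by simp
  ultimately show ?thesis using assms unfolding trunc_log_def t_def[symmetric] by linarith
qed

text \<open>
  Passage to the limit \<open>M \<rightarrow> \<infinity>\<close> in the truncation level. The cut-off kernel is split into its
  positive part, which increases with \<open>M\<close>, and its negative part, which does not depend on \<open>M\<close>.
\<close>

lemma weighted_energy_le_of_truncations:
  fixes \<mu> :: "complex measure" and g :: "real \<Rightarrow> real"
  assumes mu: "prob_space \<mu>" "sets \<mu> = sets borel"
    and g: "mono_on {0..} g" "\<And>r. 0 \<le> r \<Longrightarrow> 0 \<le> g r"
    and R: "0 \<le> R" "AE z in \<mu>. cmod z \<le> R"
    and b: "1 \<le> b"
    and le: "\<And>M. 0 \<le> M \<Longrightarrow>
      (LINT x|(\<mu> \<Otimes>\<^sub>M \<mu>). trunc_log M b (fst x) (snd x)) + (LINT z|\<mu>. g (min R (cmod z))) \<le> B"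
  shows "weighted_energy g \<mu> \<le> ereal B"
proof -
  interpret mu: prob_space \<mu> by fact
  interpret pp: pair_prob_space \<mu> \<mu> ..
  note [measurable_cong] = mu(2)
  note [measurable] = measurable_radial[OF g(1)]
  have mono': "mono_on {0..} (\<lambda>r. g (min R r))"
    using g(1) R by (auto simp: mono_on_def)
  note [measurable] = measurable_radial[OF mono']
  have gb: "0 \<le> g (min R (cmod z))" "g (min R (cmod z)) \<le> g R" for z :: complex
    using g R by (auto simp: mono_on_def)
  define Gr where "Gr = (LINT z|\<mu>. g (min R (cmod z)))"
  have gint: "integrable \<mu> (\<lambda>z. g (min R (cmod z)))"
    by (rule mu.integrable_const_bound[of _ "g R"]) (use gb in auto)
  have "(\<integral>\<^sup>+ z. e2ennreal (ereal (g (cmod z))) \<partial>\<mu>) = (\<integral>\<^sup>+ z. ennreal (g (min R (cmod z))) \<partial>\<mu>)"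
    using R(2) by (intro nn_integral_cong_AE) (auto simp: min_def)
  also have "\<dots> = ennreal Gr"
    unfolding Gr_def using gint gb by (intro nn_integral_eq_integral) auto
  finally have Gpos: "(\<integral>\<^sup>+ z. e2ennreal (ereal (g (cmod z))) \<partial>\<mu>) = ennreal Gr" .
  have Gneg: "(\<integral>\<^sup>+ z. e2ennreal (- ereal (g (cmod z))) \<partial>\<mu>) = 0"
    using g(2) by (simp add: e2ennreal_neg ennreal_neg)
  have "0 \<le> Gr" unfolding Gr_def using gb by (simp add: integral_nonneg_AE)
  then have G: "ext_integral \<mu> (\<lambda>z. ereal (g (cmod z))) = ereal Gr"
    unfolding ext_integral_def Gpos Gneg by (simp add: zero_ennreal.rep_eq)
  define pos where "pos M x = - ln (max (exp (- M)) (min 1 (cmod (fst x - snd x))))" for M :: real and x :: "complex \<times> complex"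
  define neg where "neg x = ln (max 1 (min b (cmod (fst x - snd x))))" for x :: "complex \<times> complex"
  have [measurable]: "pos M \<in> borel_measurable (\<mu> \<Otimes>\<^sub>M \<mu>)" "neg \<in> borel_measurable (\<mu> \<Otimes>\<^sub>M \<mu>)" for M
    unfolding pos_def neg_def by measurable
  have split: "trunc_log M b (fst x) (snd x) = pos M x - neg x" if "0 \<le> M" for M x
  proof -
    have "exp (- M) \<le> 1" using that by simp
    then have e: "max (exp (- M)) 1 = 1"
      "1 < d \<Longrightarrow> max (exp (- M)) (min b d) = min b d" for d
      using b by linarith+
    show ?thesis
      using b e by (cases "cmod (fst x - snd x) \<le> 1")
        (simp_all add: trunc_log_def pos_def neg_def min_absorb2 min_absorb1 max_absorb1 max_absorb2 not_le)
  qed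
  have pos_b: "0 \<le> pos M x \<and> pos M x \<le> M" if "0 \<le> M" for M x
  proof -
    have "exp (- M) \<le> 1" using that by simp
    moreover have "0 < max (exp (- M)) (min 1 (cmod (fst x - snd x)))"
      using exp_gt_zero[of "- M"] by linarith
    ultimately have "ln (max (exp (- M)) (min 1 (cmod (fst x - snd x)))) \<le> 0"
      by (subst ln_le_zero_iff) linarith+
    then show ?thesis
      using abs_trunc_log_le[of 1 M "fst x" "snd x"] that unfolding trunc_log_def pos_def by simp
  qed
  have neg_b: "0 \<le> neg x \<and> neg x \<le> ln b" for x
    using b by (auto simp: neg_def max_def min_def)
  have pos_int: "integrable (\<mu> \<Otimes>\<^sub>M \<mu>) (pos M)" if "0 \<le> M" for M
    by (rule pp.P.integrable_const_bound[of _ M]) (use pos_b[OF that] in \<open>auto intro!: AE_I2\<close>)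
  have neg_int: "integrable (\<mu> \<Otimes>\<^sub>M \<mu>) neg"
    by (rule pp.P.integrable_const_bound[of _ "ln b"]) (use neg_b in \<open>auto intro!: AE_I2\<close>)
  define Nr where "Nr = (LINT x|(\<mu> \<Otimes>\<^sub>M \<mu>). neg x)"
  define Q where "Q = B - Gr + Nr"
  have posQ: "(LINT x|(\<mu> \<Otimes>\<^sub>M \<mu>). pos M x) \<le> Q" if "0 \<le> M" for M
    using le[OF that] pos_int[OF that] neg_int by (simp add: split that Q_def Gr_def Nr_def)
  define f where "f x = e2ennreal (- log_ennreal (ennreal (cmod (fst x - snd x))))" for x :: "complex \<times> complex"
  have lim: "(\<lambda>n. ennreal (pos (real n) x)) \<longlonglongrightarrow> f x" for x
  proof (cases "fst x = snd x")
    case True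
    have "(\<lambda>n. ennreal (real n)) \<longlonglongrightarrow> \<infinity>"
      by (simp add: ennreal_of_nat_eq_real_of_nat[symmetric] of_nat_tendsto_top_ennreal)
    then show ?thesis using True by (simp add: f_def pos_def log_ennreal_def max_def)
  next
    case False
    then have d: "0 < cmod (fst x - snd x)" (is "0 < ?d") by simp
    obtain N :: nat where N: "- ln ?d \<le> real N" using real_arch_simple by blast
    have "ennreal (pos (real n) x) = f x" if "N \<le> n" for n
    proof -
      have "- real n \<le> ln ?d" using N that by linarith
      then have "exp (- real n) \<le> ?d" using d by (simp add: ln_ge_iff)
      then have "pos (real n) x = - ln (min 1 ?d)" unfolding pos_def by (simp add: max_def)
      moreover have "f x = ennreal (- ln ?d)" using d by (simp add: f_def log_ennreal_def)
      ultimately show ?thesis using d by (auto simp: min_def ennreal_neg)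
    qed
    then show ?thesis by (intro tendsto_eventually eventually_sequentiallyI)
  qed
  have "(\<integral>\<^sup>+ x. f x \<partial>(\<mu> \<Otimes>\<^sub>M \<mu>)) = (\<integral>\<^sup>+ x. liminf (\<lambda>n. ennreal (pos (real n) x)) \<partial>(\<mu> \<Otimes>\<^sub>M \<mu>))"
    using lim_imp_Liminf[OF _ lim] by (intro nn_integral_cong) simp
  also have "\<dots> \<le> liminf (\<lambda>n. \<integral>\<^sup>+ x. ennreal (pos (real n) x) \<partial>(\<mu> \<Otimes>\<^sub>M \<mu>))"
    by (rule nn_integral_liminf) measurable
  also have "\<dots> \<le> ennreal Q"
  proof (intro Liminf_le always_eventually allI)
    fix n
    have "(\<integral>\<^sup>+ x. ennreal (pos (real n) x) \<partial>(\<mu> \<Otimes>\<^sub>M \<mu>)) = ennreal (LINT x|(\<mu> \<Otimes>\<^sub>M \<mu>). pos (real n) x)"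
      using pos_b by (intro nn_integral_eq_integral pos_int) auto
    also have "\<dots> \<le> ennreal Q" by (intro ennreal_leI posQ) auto
    finally show "(\<integral>\<^sup>+ x. ennreal (pos (real n) x) \<partial>(\<mu> \<Otimes>\<^sub>M \<mu>)) \<le> ennreal Q" .
  qed auto
  finally have P: "(\<integral>\<^sup>+ x. f x \<partial>(\<mu> \<Otimes>\<^sub>M \<mu>)) \<le> ennreal Q" .
  have Q0: "0 \<le> Q" using order_trans[OF integral_nonneg_AE posQ[of 0]] pos_b[of 0] by auto
  define h where "h x = e2ennreal (log_ennreal (ennreal (cmod (fst x - snd x))))" for x :: "complex \<times> complex"
  have "ennreal Nr = (\<integral>\<^sup>+ x. ennreal (neg x) \<partial>(\<mu> \<Otimes>\<^sub>M \<mu>))"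
    unfolding Nr_def using neg_b by (intro nn_integral_eq_integral[symmetric] neg_int) auto
  also have "\<dots> \<le> (\<integral>\<^sup>+ x. h x \<partial>(\<mu> \<Otimes>\<^sub>M \<mu>))"
  proof (rule nn_integral_mono)
    fix x :: "complex \<times> complex"
    show "ennreal (neg x) \<le> h x"
      using b by (auto simp: neg_def h_def log_ennreal_def max_def min_def intro!: ennreal_leI)
  qed
  finally have N: "ennreal Nr \<le> (\<integral>\<^sup>+ x. h x \<partial>(\<mu> \<Otimes>\<^sub>M \<mu>))" .
  have Nr0: "0 \<le> Nr" unfolding Nr_def using neg_b by (auto intro!: integral_nonneg_AE)
  have "ext_integral (\<mu> \<Otimes>\<^sub>M \<mu>) (\<lambda>(z, w). - log_ennreal (ennreal (cmod (z - w))))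
      = enn2ereal (\<integral>\<^sup>+ x. f x \<partial>(\<mu> \<Otimes>\<^sub>M \<mu>)) - enn2ereal (\<integral>\<^sup>+ x. h x \<partial>(\<mu> \<Otimes>\<^sub>M \<mu>))"
    by (simp add: ext_integral_def f_def h_def case_prod_beta)
  also have "\<dots> \<le> ereal Q - ereal Nr"
    using P N Q0 Nr0 by (intro ereal_minus_mono) (auto simp: less_eq_ennreal.rep_eq enn2ereal_ennreal)
  finally have "weighted_energy g \<mu> \<le> (ereal Q - ereal Nr) + ereal Gr"
    unfolding weighted_energy_def G by (intro add_right_mono)
  also have "\<dots> = ereal B" by (simp add: Q_def)
  finally show ?thesis .
qed

text \<open>
  Lower semicontinuity of the energy, combined with compactness. The double integrals of
  the truncated kernel include the diagonal, on which it has the finite value \<open>M\<close>.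
\<close>

lemma limit_measure_energy_le:
  fixes p :: "nat \<Rightarrow> complex pmf" and g :: "real \<Rightarrow> real"
  assumes K: "compact K" "\<And>n. set_pmf (p n) \<subseteq> K"
    and g: "mono_on {0..} g" "\<And>r. 0 \<le> r \<Longrightarrow> 0 \<le> g r" "continuous_on {0<..} g"
    and R: "0 < R" "\<And>z. z \<in> K \<Longrightarrow> cmod z \<le> R"
    and b: "1 \<le> b"
    and le: "\<And>M e. 0 \<le> M \<Longrightarrow> 0 < e \<Longrightarrow> eventually (\<lambda>n.
      (LINT z|measure_pmf (p n). LINT w|measure_pmf (p n). trunc_log M b z w)
        + (LINT z|measure_pmf (p n). g (cmod z)) \<le> B + e) sequentially"
  obtains \<mu> where "\<mu> \<in> compact_prob_measures K" "weighted_energy g \<mu> \<le> ereal B"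
proof -
  obtain s \<Omega> X Y where s: "strict_mono s" and Om: "prob_space (\<Omega> :: real measure)"
    and X [measurable]: "\<And>n. X n \<in> borel_measurable \<Omega>" and Y [measurable]: "Y \<in> borel_measurable \<Omega>"
    and dX: "\<And>n. distr \<Omega> borel (X n) = distr (measure_pmf (p (s n))) borel id"
    and lim: "\<And>\<omega>. \<omega> \<in> space \<Omega> \<Longrightarrow> (\<lambda>n. X n \<omega>) \<longlonglongrightarrow> Y \<omega>"
    using bounded_pmf_sequence_skorohod[of K p] K compact_imp_bounded by metis
  interpret Om: prob_space \<Omega> by fact
  interpret OO: pair_prob_space \<Omega> \<Omega> ..
  define \<mu> where "\<mu> = distr \<Omega> borel Y"
  have [measurable]: "K \<in> sets borel" using K(1) by (simp add: borel_compact)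
  \<comment> \<open>The random points, hence also their limit, lie in \<open>K\<close> almost surely.\<close>
  have "AE \<omega> in \<Omega>. \<forall>n. X n \<omega> \<in> K"
  proof (subst AE_all_countable, rule allI)
    fix n
    have "AE x in distr (measure_pmf (p (s n))) borel id. x \<in> K"
      using K(2) by (subst AE_distr_iff) (auto intro!: AE_pmfI)
    then show "AE \<omega> in \<Omega>. X n \<omega> \<in> K" unfolding dX[symmetric] by (subst (asm) AE_distr_iff) auto
  qed
  then have YK: "AE \<omega> in \<Omega>. Y \<omega> \<in> K"
  proof (rule AE_mp, intro AE_I2 impI)
    fix \<omega> assume "\<omega> \<in> space \<Omega>" "\<forall>n. X n \<omega> \<in> K"
    then show "Y \<omega> \<in> K"
      using lim[of \<omega>] closed_sequentially[OF compact_imp_closed[OF K(1)], of "\<lambda>n. X n \<omega>"] by blast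
  qed
  have muK: "AE z in \<mu>. z \<in> K"
    unfolding \<mu>_def using YK by (subst AE_distr_iff) auto
  have mu: "prob_space \<mu>" "sets \<mu> = sets borel"
    unfolding \<mu>_def by (auto intro!: Om.prob_space_distr)
  have supp: "measure_support \<mu> \<subseteq> K"
  proof
    fix z assume z: "z \<in> measure_support \<mu>"
    show "z \<in> K"
    proof (rule ccontr)
      assume "z \<notin> K"
      then have "emeasure \<mu> (- K) > 0"
        using z compact_imp_closed[OF K(1)] unfolding measure_support_def by (auto simp: open_Compl)
      moreover have "emeasure \<mu> (- K) = 0"
        using muK by (subst (asm) AE_iff_measurable[OF _ refl]) (auto simp: mu \<mu>_def Compl_eq)
      ultimately show False by simp
    qed
  qed
  have "open (- measure_support \<mu>)"
  proof (subst open_subopen, intro ballI)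
    fix z assume "z \<in> - measure_support \<mu>"
    then obtain V where "open V" "z \<in> V" "\<not> emeasure \<mu> V > 0" unfolding measure_support_def by auto
    then show "\<exists>T. open T \<and> z \<in> T \<and> T \<subseteq> - measure_support \<mu>"
      unfolding measure_support_def by (intro exI[of _ V]) auto
  qed
  then have "closed (measure_support \<mu>)" by (simp add: closed_def)
  then have "compact (measure_support \<mu>)"
    using compact_Int_closed[OF K(1)] supp by (metis Int_absorb1)
  then have mem: "\<mu> \<in> compact_prob_measures K"
    using mu supp by (simp add: compact_prob_measures_def)
  have mono': "mono_on {0..} (\<lambda>r. g (min R r))"
    using g(1) R by (auto simp: mono_on_def)
  note [measurable] = measurable_radial[OF mono']
  have gb: "0 \<le> g (min R (cmod z))" "g (min R (cmod z)) \<le> g R" for z :: complex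
    using g R by (auto simp: mono_on_def)
  have "weighted_energy g \<mu> \<le> ereal B"
  proof (rule weighted_energy_le_of_truncations[OF mu g(1,2) less_imp_le[OF R(1)] _ b])
    show "AE z in \<mu>. cmod z \<le> R" using muK R(2) by auto
    fix M :: real assume M: "0 \<le> M"
    define L where "L x = trunc_log M b (fst x) (snd x)" for x
    define gR where "gR z = g (min R (cmod z))" for z :: complex
    have [measurable]: "L \<in> borel_measurable (borel \<Otimes>\<^sub>M borel)" unfolding L_def by measurable
    have [measurable]: "gR \<in> borel_measurable borel" unfolding gR_def by measurable
    have Lb: "\<bar>L x\<bar> \<le> M + ln b" for x unfolding L_def by (rule abs_trunc_log_le[OF b M])
    have Lint: "integrable (\<Omega> \<Otimes>\<^sub>M \<Omega>) (\<lambda>x. L (X n (fst x), X n (snd x)))" for n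
      by (rule OO.P.integrable_const_bound[of _ "M + ln b"]) (use Lb in auto)
    have Leq: "(LINT x|(\<Omega> \<Otimes>\<^sub>M \<Omega>). L (X n (fst x), X n (snd x))) =
        (LINT z|measure_pmf (p (s n)). LINT w|measure_pmf (p (s n)). trunc_log M b z w)" for n
    proof -
      have *: "(LINT \<omega>|\<Omega>. f (X n \<omega>)) = (LINT z|measure_pmf (p (s n)). f z)"
        if [measurable]: "f \<in> borel_measurable borel" for f :: "complex \<Rightarrow> real"
      proof -
        have "(LINT \<omega>|\<Omega>. f (X n \<omega>)) = (LINT z|distr \<Omega> borel (X n). f z)"
          by (rule integral_distr[symmetric]) auto
        also have "\<dots> = (LINT z|measure_pmf (p (s n)). f z)"
          unfolding dX by (subst integral_distr) auto
        finally show ?thesis .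
      qed
      have "(LINT x|(\<Omega> \<Otimes>\<^sub>M \<Omega>). L (X n (fst x), X n (snd x))) = (LINT \<omega>|\<Omega>. LINT \<omega>'|\<Omega>. L (X n \<omega>, X n \<omega>'))"
        using OO.integral_fst'[OF Lint[of n]] by simp
      also have "\<dots> = (LINT \<omega>|\<Omega>. LINT w|measure_pmf (p (s n)). L (X n \<omega>, w))"
        by (intro Bochner_Integration.integral_cong refl *) measurable
      also have "\<dots> = (LINT z|measure_pmf (p (s n)). LINT w|measure_pmf (p (s n)). L (z, w))"
      proof (rule *)
        have "(\<lambda>z. LINT w|distr \<Omega> borel (X n). L (z, w)) \<in> borel_measurable borel"
        proof -
          interpret D: prob_space "distr \<Omega> borel (X n)" by (rule Om.prob_space_distr) auto
          show ?thesis by measurable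
        qed
        then show "(\<lambda>z. LINT w|measure_pmf (p (s n)). L (z, w)) \<in> borel_measurable borel"
          unfolding dX by (subst (asm) integral_distr) auto
      qed
      finally show ?thesis by (simp add: L_def)
    qed
    have geq: "(LINT \<omega>|\<Omega>. gR (X n \<omega>)) = (LINT z|measure_pmf (p (s n)). g (cmod z))" for n
    proof -
      have "(LINT \<omega>|\<Omega>. gR (X n \<omega>)) = (LINT z|distr \<Omega> borel (X n). gR z)"
        by (rule integral_distr[symmetric]) auto
      also have "\<dots> = (LINT z|measure_pmf (p (s n)). gR z)"
        unfolding dX by (subst integral_distr) auto
      also have "\<dots> = (LINT z|measure_pmf (p (s n)). g (cmod z))"
      proof (intro integral_cong_AE AE_pmfI)
        fix z assume "z \<in> set_pmf (p (s n))"
        then show "gR z = g (cmod z)" using K(2)[of "s n"] R(2)[of z] by (auto simp: gR_def min_absorb2 subset_iff)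
      qed auto
      finally show ?thesis .
    qed
    have Llim: "(\<lambda>n. LINT x|(\<Omega> \<Otimes>\<^sub>M \<Omega>). L (X n (fst x), X n (snd x))) \<longlonglongrightarrow>
        (LINT x|(\<Omega> \<Otimes>\<^sub>M \<Omega>). L (Y (fst x), Y (snd x)))"
    proof (rule integral_dominated_convergence[where w = "\<lambda>_. M + ln b"])
      show "AE x in \<Omega> \<Otimes>\<^sub>M \<Omega>. (\<lambda>n. L (X n (fst x), X n (snd x))) \<longlonglongrightarrow> L (Y (fst x), Y (snd x))"
      proof (rule AE_I2)
        fix x assume "x \<in> space (\<Omega> \<Otimes>\<^sub>M \<Omega>)"
        then have "(\<lambda>n. (X n (fst x), X n (snd x))) \<longlonglongrightarrow> (Y (fst x), Y (snd x))"
          by (intro tendsto_Pair lim) (auto simp: space_pair_measure)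
        then show "(\<lambda>n. L (X n (fst x), X n (snd x))) \<longlonglongrightarrow> L (Y (fst x), Y (snd x))"
          unfolding L_def by (rule continuous_on_tendsto_compose[OF continuous_trunc_log]) auto
      qed
    qed (use Lb in auto)
    \<comment> \<open>As \<open>g\<close> may jump at \<open>0\<close>, only \<open>g \<bar>Y\<bar> \<le> liminf g \<bar>X\<^sub>n\<bar>\<close> holds; taking the minimum with the limit restores convergence.\<close>
    have glim: "(\<lambda>n. LINT \<omega>|\<Omega>. min (gR (X n \<omega>)) (gR (Y \<omega>))) \<longlonglongrightarrow> (LINT \<omega>|\<Omega>. gR (Y \<omega>))"
    proof (rule integral_dominated_convergence[where w = "\<lambda>_. g R"])
      show "AE \<omega> in \<Omega>. (\<lambda>n. min (gR (X n \<omega>)) (gR (Y \<omega>))) \<longlonglongrightarrow> gR (Y \<omega>)"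
      proof (rule AE_I2)
        fix \<omega> assume om: "\<omega> \<in> space \<Omega>"
        show "(\<lambda>n. min (gR (X n \<omega>)) (gR (Y \<omega>))) \<longlonglongrightarrow> gR (Y \<omega>)"
        proof (cases "Y \<omega> = 0")
          case True
          have "gR (Y \<omega>) \<le> gR (X n \<omega>)" for n
            using g(1) R(1) True by (auto simp: gR_def mono_on_def)
          then show ?thesis by (simp add: min_absorb2)
        next
          case False
          have ev: "eventually (\<lambda>n. X n \<omega> \<noteq> 0) sequentially"
            using tendsto_imp_eventually_ne[OF lim[OF om] False] .
          have "(\<lambda>n. min R (cmod (X n \<omega>))) \<longlonglongrightarrow> min R (cmod (Y \<omega>))"
            by (intro tendsto_min tendsto_const tendsto_norm lim om)
          then have "(\<lambda>n. gR (X n \<omega>)) \<longlonglongrightarrow> gR (Y \<omega>)"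
            unfolding gR_def using False R(1) ev
            by (intro continuous_on_tendsto_compose[OF g(3)]) (auto elim!: eventually_mono)
          then have "(\<lambda>n. min (gR (X n \<omega>)) (gR (Y \<omega>))) \<longlonglongrightarrow> min (gR (Y \<omega>)) (gR (Y \<omega>))"
            by (intro tendsto_min tendsto_const)
          then show ?thesis by simp
        qed
      qed
      show "AE \<omega> in \<Omega>. norm (min (gR (X n \<omega>)) (gR (Y \<omega>))) \<le> g R" for n
        using gb by (auto simp: gR_def min_def)
    qed auto
    have gint: "integrable \<Omega> (\<lambda>\<omega>. gR (X n \<omega>))" "integrable \<Omega> (\<lambda>\<omega>. gR (Y \<omega>))" for n
      by (auto intro!: Om.integrable_const_bound[of _ "g R"] AE_I2 simp: gR_def gb)
    have tot: "(LINT x|(\<Omega> \<Otimes>\<^sub>M \<Omega>). L (Y (fst x), Y (snd x))) + (LINT \<omega>|\<Omega>. gR (Y \<omega>)) \<le> B"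
    proof (rule field_le_epsilon)
      fix e :: real assume "0 < e"
      have "eventually (\<lambda>n. (LINT x|(\<Omega> \<Otimes>\<^sub>M \<Omega>). L (X n (fst x), X n (snd x)))
          + (LINT \<omega>|\<Omega>. min (gR (X n \<omega>)) (gR (Y \<omega>))) \<le> B + e) sequentially"
        using eventually_subseq[OF s le[OF M \<open>0 < e\<close>]]
      proof eventually_elim
        case (elim n)
        have "(LINT \<omega>|\<Omega>. min (gR (X n \<omega>)) (gR (Y \<omega>))) \<le> (LINT \<omega>|\<Omega>. gR (X n \<omega>))"
          using gint by (intro integral_mono) auto
        then show ?case using elim unfolding Leq geq[symmetric] by linarith
      qed
      then show "(LINT x|(\<Omega> \<Otimes>\<^sub>M \<Omega>). L (Y (fst x), Y (snd x))) + (LINT \<omega>|\<Omega>. gR (Y \<omega>)) \<le> B + e"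
        using tendsto_add[OF Llim glim] by (intro tendsto_upperbound) auto
    qed
    have "\<mu> \<Otimes>\<^sub>M \<mu> = distr (\<Omega> \<Otimes>\<^sub>M \<Omega>) (borel \<Otimes>\<^sub>M borel) (\<lambda>(x, y). (Y x, Y y))"
      unfolding \<mu>_def by (rule pair_measure_distr) (auto intro!: prob_space_imp_sigma_finite Om.prob_space_distr)
    then have "(LINT x|(\<mu> \<Otimes>\<^sub>M \<mu>). L x) = (LINT x|(\<Omega> \<Otimes>\<^sub>M \<Omega>). L (Y (fst x), Y (snd x)))"
      by (simp add: integral_distr case_prod_beta)
    moreover have "(LINT z|\<mu>. gR z) = (LINT \<omega>|\<Omega>. gR (Y \<omega>))"
      unfolding \<mu>_def by (simp add: integral_distr)
    ultimately show "(LINT x|(\<mu> \<Otimes>\<^sub>M \<mu>). trunc_log M b (fst x) (snd x)) + (LINT z|\<mu>. g (min R (cmod z))) \<le> B"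
      using tot unfolding L_def gR_def by simp
  qed
  with mem show ?thesis by (rule that)
qed

section \<open>Energy of configurations\<close>

text \<open>
  The weighted energy of a configuration, summed over ordered pairs of distinct indices. It is
  meaningful only for distinct points, because \<open>ln 0 = 0\<close>.
\<close>

definition pair_energy :: "(real \<Rightarrow> real) \<Rightarrow> nat \<Rightarrow> (nat \<Rightarrow> complex) \<Rightarrow> real" where
  "pair_energy g n z = (\<Sum>i<n. \<Sum>j\<in>{..<n} - {i}.
     g (cmod (z i)) / 2 + g (cmod (z j)) / 2 - ln (cmod (z i - z j)))"

lemma sum_off_diagonal_symmetric:
  fixes f :: "nat \<Rightarrow> nat \<Rightarrow> real"
  assumes "\<And>i j. f i j = f j i"
  shows "(\<Sum>i<n. \<Sum>j\<in>{..<n} - {i}. f i j) = 2 * (\<Sum>j<n. \<Sum>i<j. f i j)"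
proof (induction n)
  case (Suc n)
  have row: "(\<Sum>j\<in>{..<Suc n} - {i}. f i j) = (\<Sum>j\<in>{..<n} - {i}. f i j) + f i n" if "i < n" for i
  proof -
    have "{..<Suc n} - {i} = insert n ({..<n} - {i})" using that by auto
    then show ?thesis by simp
  qed
  have "{..<Suc n} - {n} = {..<n}" by auto
  then show ?case
    using row Suc.IH assms[of n] by (simp add: sum.distrib)
qed simp

lemma gas_weight_eq_exp_pair_energy:
  assumes "inj_on z {..<n}"
  shows "gas_weight g n z = exp (- pair_energy g n z) * (\<Prod>k<n. exp (- g (cmod (z k))))"
proof -
  have "(\<Prod>j<n. \<Prod>i<j. (cmod (z i - z j))\<^sup>2) = (\<Prod>j<n. \<Prod>i<j. exp (2 * ln (cmod (z i - z j))))"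
  proof (intro prod.cong refl)
    fix i j assume "j \<in> {..<n}" "i \<in> {..<j}"
    then have "z i \<noteq> z j" using assms by (auto simp: inj_on_def)
    then show "(cmod (z i - z j))\<^sup>2 = exp (2 * ln (cmod (z i - z j)))"
      by (simp add: exp_double)
  qed
  also have "\<dots> = exp (2 * (\<Sum>j<n. \<Sum>i<j. ln (cmod (z i - z j))))"
    by (simp add: exp_sum sum_distrib_left)
  finally have prod: "(\<Prod>j<n. \<Prod>i<j. (cmod (z i - z j))\<^sup>2) = exp (2 * (\<Sum>j<n. \<Sum>i<j. ln (cmod (z i - z j))))" .
  have "pair_energy g n z = (\<Sum>i<n. \<Sum>j\<in>{..<n} - {i}. g (cmod (z i)) / 2)
      + (\<Sum>i<n. \<Sum>j\<in>{..<n} - {i}. g (cmod (z j)) / 2) - (\<Sum>i<n. \<Sum>j\<in>{..<n} - {i}. ln (cmod (z i - z j)))"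
    by (simp add: pair_energy_def sum.distrib sum_subtractf)
  also have "(\<Sum>i<n. \<Sum>j\<in>{..<n} - {i}. ln (cmod (z i - z j))) = 2 * (\<Sum>j<n. \<Sum>i<j. ln (cmod (z i - z j)))"
    by (rule sum_off_diagonal_symmetric) (simp add: norm_minus_commute)
  also have "(\<Sum>i<n. \<Sum>j\<in>{..<n} - {i}. g (cmod (z i)) / 2) = (real n - 1) / 2 * (\<Sum>i<n. g (cmod (z i)))"
    by (simp add: sum_distrib_left of_nat_diff)
  also have "(\<Sum>i<n. \<Sum>j\<in>{..<n} - {i}. g (cmod (z j)) / 2) = (real n - 1) / 2 * (\<Sum>i<n. g (cmod (z i)))"
    by (simp add: sum_diff1 sum_subtractf sum_distrib_left field_simps sum_divide_distrib[symmetric])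
  finally have "pair_energy g n z + (\<Sum>i<n. g (cmod (z i))) =
      real n * (\<Sum>i<n. g (cmod (z i))) - 2 * (\<Sum>j<n. \<Sum>i<j. ln (cmod (z i - z j)))"
    by (simp add: field_simps)
  moreover have "(\<Prod>k<n. exp (- g (cmod (z k)))) = exp (- (\<Sum>k<n. g (cmod (z k))))"
    by (simp add: exp_sum[symmetric] sum_negf)
  ultimately show ?thesis
    unfolding gas_weight_def prod by (simp add: exp_add[symmetric])
qed

lemma weight_dominates_log:
  fixes g :: "real \<Rightarrow> real"
  assumes "((\<lambda>r. r * exp (- g r / 2)) \<longlongrightarrow> 0) at_top"
  obtains R where "0 < R" "\<And>r. R \<le> r \<Longrightarrow> H \<le> g r / 2 - ln (1 + r)"
proof -
  have "eventually (\<lambda>r. r * exp (- g r / 2) < exp (- H) / 2) at_top"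
    by (rule order_tendstoD(2)[OF assms]) simp
  then obtain R where R: "\<And>r. R \<le> r \<Longrightarrow> r * exp (- g r / 2) < exp (- H) / 2"
    by (auto simp: eventually_at_top_linorder)
  show ?thesis
  proof (rule that[of "max 1 R"])
    fix r assume r: "max 1 R \<le> r"
    have "(1 + r) * exp (- g r / 2) \<le> 2 * r * exp (- g r / 2)"
      using r by (intro mult_right_mono) auto
    also have "\<dots> \<le> exp (- H)" using R[of r] r by simp
    finally have "ln ((1 + r) * exp (- g r / 2)) \<le> ln (exp (- H))"
      using r by (subst ln_le_cancel_iff) auto
    then show "H \<le> g r / 2 - ln (1 + r)" using r by (simp add: ln_mult)
  qed simp
qed

text \<open>
  For \<open>z = w\<close> the right-hand side is \<open>0\<close> by the convention for \<open>ln 0\<close>.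
\<close>

lemma pair_log_lower_bound:
  fixes z w :: complex
  shows "- ln (1 + cmod z) - ln (1 + cmod w) \<le> - ln (cmod (z - w))"
proof (cases "z = w")
  case False
  have "cmod (z - w) \<le> cmod z + cmod w" by (rule norm_triangle_ineq4)
  also have "\<dots> \<le> (1 + cmod z) * (1 + cmod w)" by (simp add: algebra_simps)
  finally have "ln (cmod (z - w)) \<le> ln ((1 + cmod z) * (1 + cmod w))"
    using False by (subst ln_le_cancel_iff) (auto intro!: mult_pos_pos add_pos_nonneg)
  also have "\<dots> = ln (1 + cmod z) + ln (1 + cmod w)"
    by (rule ln_mult_pos) (simp_all add: add_pos_nonneg)
  finally show ?thesis by simp
qed simp

text \<open>
  The set \<open>I\<close> indexes the points in the disc of radius \<open>R\<close>. If the energy of the configuration is at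
  most \<open>A n\<^sup>2\<close>, at least \<open>(1 - \<epsilon>) n\<close> of the points lie there, and the truncated energy of their
  empirical measure exceeds \<open>A\<close> by at most an error that is small when \<open>\<epsilon>\<close> is small and \<open>n\<close> is large.
  The last summand of the bound accounts for the diagonal.
\<close>

lemma low_energy_configuration:
  fixes z :: "nat \<Rightarrow> complex" and g :: "real \<Rightarrow> real"
    and A C \<epsilon> R :: real
  assumes n: "2 \<le> n" and inj: "inj_on z {..<n}" and low: "pair_energy g n z \<le> A * (real n)\<^sup>2"
    and mono: "mono_on {0..} g" and nonneg: "\<And>r. 0 \<le> r \<Longrightarrow> 0 \<le> g r"
    and C: "0 \<le> C" "\<And>r. 0 \<le> r \<Longrightarrow> - C \<le> g r / 2 - ln (1 + r)"
    and eps: "0 < \<epsilon>" "\<epsilon> < 1" and R: "0 < R" "\<And>r. R \<le> r \<Longrightarrow> (A + 2 * C + 1) / \<epsilon> \<le> g r / 2 - ln (1 + r)"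
  obtains I where "I \<subseteq> {..<n}" "I \<noteq> {}" "\<And>i. i \<in> I \<Longrightarrow> cmod (z i) \<le> R"
    "\<And>M. 0 \<le> M \<Longrightarrow>
      (LINT x|measure_pmf (map_pmf z (pmf_of_set I)). LINT y|measure_pmf (map_pmf z (pmf_of_set I)). trunc_log M (2 * R + 1) x y)
        + (LINT x|measure_pmf (map_pmf z (pmf_of_set I)). g (cmod x))
      \<le> (A + 2 * C) / (1 - \<epsilon>)\<^sup>2 - 2 * C + (M + g R + 2 * C) / ((1 - \<epsilon>) * real n)"
proof -
  define h where "h i = g (cmod (z i)) / 2 - ln (1 + cmod (z i)) + C" for i
  \<comment> \<open>The shift by \<open>2 * C\<close> makes the kernel nonnegative, so that pairs with an outer point may be dropped.\<close>
  define k where "k i j = g (cmod (z i)) / 2 + g (cmod (z j)) / 2 - ln (cmod (z i - z j)) + 2 * C" for i j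
  have h0: "0 \<le> h i" for i using C(2)[of "cmod (z i)"] by (simp add: h_def)
  have kh: "h i + h j \<le> k i j" for i j
    using pair_log_lower_bound[of "z i" "z j"] by (simp add: h_def k_def)
  have k0: "0 \<le> k i j" for i j using kh[of i j] h0[of i] h0[of j] by linarith
  define I where "I = {i \<in> {..<n}. cmod (z i) \<le> R}"
  have fin: "finite I" and sub: "I \<subseteq> {..<n}" by (auto simp: I_def)
  define m where "m = card I"
  have "(\<Sum>i<n. \<Sum>j\<in>{..<n} - {i}. k i j) = pair_energy g n z + 2 * C * (real n * (real n - 1))"
    using n by (simp add: k_def pair_energy_def sum.distrib sum_subtractf of_nat_diff mult_ac)
  also have "\<dots> \<le> A * (real n)\<^sup>2 + 2 * C * (real n)\<^sup>2"
  proof (intro add_mono mult_left_mono)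
    show "real n * (real n - 1) \<le> (real n)\<^sup>2"
      by (simp add: power2_eq_square algebra_simps)
  qed (use low C in auto)
  finally have tot: "(\<Sum>i<n. \<Sum>j\<in>{..<n} - {i}. k i j) \<le> (A + 2 * C) * (real n)\<^sup>2"
    by (simp add: algebra_simps)
  have "0 \<le> (\<Sum>i<n. \<Sum>j\<in>{..<n} - {i}. k i j)" by (intro sum_nonneg k0)
  with tot have "0 \<le> (A + 2 * C) * (real n)\<^sup>2" by linarith
  then have AC: "0 \<le> A + 2 * C" using n by (simp add: zero_le_mult_iff)
  \<comment> \<open>The summand \<open>1\<close> keeps \<open>H\<close> positive when \<open>A + 2 * C = 0\<close>.\<close>
  define H where "H = (A + 2 * C + 1) / \<epsilon>"
  have H: "0 < H" using AC eps by (simp add: H_def)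
  have out: "H \<le> h i" if "i \<in> {..<n} - I" for i
    using R(2)[of "cmod (z i)"] that C(1) by (auto simp: I_def h_def H_def)
  have mn: "m \<le> n" using card_mono[OF _ sub] by (simp add: m_def)
  have m: "(1 - \<epsilon>) * real n \<le> real m"
  proof -
    have "(real n - real m) * H = (\<Sum>i\<in>{..<n} - I. H)"
      using sub fin mn by (simp add: card_Diff_subset m_def of_nat_diff)
    also have "\<dots> \<le> (\<Sum>i\<in>{..<n} - I. h i)" by (intro sum_mono out)
    also have "\<dots> \<le> (\<Sum>i<n. h i)" using h0 by (intro sum_mono2) auto
    finally have 1: "(real n - real m) * H \<le> (\<Sum>i<n. h i)" .
    have "real n * ((real n - real m) * H) \<le> 2 * (real n - 1) * ((real n - real m) * H)"
      using n mn H by (intro mult_right_mono mult_nonneg_nonneg) auto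
    also have "\<dots> \<le> 2 * (real n - 1) * (\<Sum>i<n. h i)"
      using n by (intro mult_left_mono 1) auto
    also have "\<dots> = (\<Sum>i<n. \<Sum>j\<in>{..<n} - {i}. h i + h j)"
      using n by (simp add: sum.distrib sum_diff1 sum_subtractf sum_distrib_left of_nat_diff algebra_simps)
    also have "\<dots> \<le> (\<Sum>i<n. \<Sum>j\<in>{..<n} - {i}. k i j)" by (intro sum_mono kh)
    also have "\<dots> \<le> real n * ((A + 2 * C) * real n)" using tot by (simp add: power2_eq_square mult_ac)
    also have "\<dots> \<le> real n * ((A + 2 * C + 1) * real n)"
      by (intro mult_left_mono mult_right_mono) auto
    also have "\<dots> = real n * (\<epsilon> * H * real n)" using eps by (simp add: H_def)
    finally have "real n * ((real n - real m) * H) \<le> real n * ((\<epsilon> * real n) * H)"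
      by (simp add: mult_ac)
    then have "(real n - real m) * H \<le> (\<epsilon> * real n) * H"
      using n by (subst (asm) mult_le_cancel_left_pos) auto
    then have "real n - real m \<le> \<epsilon> * real n" using H by (rule mult_right_le_imp_le)
    then show ?thesis by (simp add: algebra_simps)
  qed
  have m0: "0 < (1 - \<epsilon>) * real n" using eps n by simp
  with m have mpos: "0 < real m" by linarith
  then have ne: "I \<noteq> {}" by (auto simp: m_def)
  show ?thesis
  proof (rule that[OF sub ne])
    show "cmod (z i) \<le> R" if "i \<in> I" for i using that by (simp add: I_def)
    fix M :: real assume M: "0 \<le> M"
    define b where "b = 2 * R + 1"
    have b: "1 \<le> b" using R(1) by (simp add: b_def)
    let ?p = "measure_pmf (map_pmf z (pmf_of_set I))"
    define l where "l i j = trunc_log M b (z i) (z j) + g (cmod (z i)) / 2 + g (cmod (z j)) / 2" for i j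
    have off: "l i j \<le> k i j - 2 * C" if "i \<in> I" "j \<in> I" "i \<noteq> j" for i j
    proof -
      have "z i \<noteq> z j" using that sub inj by (auto simp: inj_on_def)
      then have d: "0 < cmod (z i - z j)" by simp
      have "cmod (z i - z j) \<le> cmod (z i) + cmod (z j)" by (rule norm_triangle_ineq4)
      also have "\<dots> \<le> b" using that by (simp add: I_def b_def)
      finally have "ln (cmod (z i - z j)) \<le> ln (max (exp (- M)) (min b (cmod (z i - z j))))"
        using d by (subst ln_le_cancel_iff) (auto simp: less_max_iff_disj)
      then show ?thesis by (simp add: l_def k_def trunc_log_def)
    qed
    have diag: "l i i \<le> M + g R" if "i \<in> I" for i
    proof -
      have "trunc_log M b (z i) (z i) = M" using b by (simp add: trunc_log_def min_def max_def)
      moreover have "g (cmod (z i)) \<le> g R" using mono that R(1) by (auto simp: mono_on_def I_def)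
      ultimately show ?thesis by (simp add: l_def)
    qed
    have "(LINT x|?p. LINT y|?p. trunc_log M b x y) + (LINT x|?p. g (cmod x))
      = (\<Sum>i\<in>I. \<Sum>j\<in>I. trunc_log M b (z i) (z j)) / (real m)\<^sup>2 + (\<Sum>i\<in>I. g (cmod (z i))) / real m"
      using ne fin by (simp add: integral_pmf_of_set m_def sum_divide_distrib[symmetric] power2_eq_square)
    also have "\<dots> = (\<Sum>i\<in>I. \<Sum>j\<in>I. l i j) / (real m)\<^sup>2"
      using mpos by (simp add: l_def sum.distrib m_def[symmetric] sum_distrib_left[symmetric] sum_divide_distrib[symmetric] field_simps power2_eq_square)
    also have "\<dots> \<le> ((A + 2 * C) * (real n)\<^sup>2 - 2 * C * (real m * (real m - 1)) + real m * (M + g R)) / (real m)\<^sup>2"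
    proof (rule divide_right_mono)
      have "(\<Sum>i\<in>I. \<Sum>j\<in>I. l i j) = (\<Sum>i\<in>I. l i i + (\<Sum>j\<in>I - {i}. l i j))"
        using fin by (intro sum.cong refl sum.remove) auto
      also have "\<dots> \<le> (\<Sum>i\<in>I. (M + g R) + (\<Sum>j\<in>I - {i}. k i j - 2 * C))"
        by (intro sum_mono add_mono diag off) auto
      also have "\<dots> = real m * (M + g R) + (\<Sum>i\<in>I. \<Sum>j\<in>I - {i}. k i j) - 2 * C * (real m * (real m - 1))"
        using mpos by (simp add: sum.distrib sum_subtractf m_def of_nat_diff Suc_le_eq card_gt_0_iff fin ne mult_ac)
      also have "(\<Sum>i\<in>I. \<Sum>j\<in>I - {i}. k i j) \<le> (\<Sum>i\<in>I. \<Sum>j\<in>{..<n} - {i}. k i j)"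
        using sub k0 by (intro sum_mono sum_mono2) auto
      also have "\<dots> \<le> (\<Sum>i<n. \<Sum>j\<in>{..<n} - {i}. k i j)"
        using sub k0 by (intro sum_mono2 sum_nonneg) auto
      also note tot
      finally show "(\<Sum>i\<in>I. \<Sum>j\<in>I. l i j)
          \<le> (A + 2 * C) * (real n)\<^sup>2 - 2 * C * (real m * (real m - 1)) + real m * (M + g R)"
        by simp
    qed simp
    also have "\<dots> = (A + 2 * C) * (real n / real m)\<^sup>2 - 2 * C + (M + g R + 2 * C) / real m"
      using mpos by (simp add: field_simps power2_eq_square)
    also have "\<dots> \<le> (A + 2 * C) * (1 / (1 - \<epsilon>))\<^sup>2 - 2 * C + (M + g R + 2 * C) / ((1 - \<epsilon>) * real n)"
    proof (intro add_mono diff_mono mult_left_mono power_mono divide_left_mono order_refl AC m)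
      show "real n / real m \<le> 1 / (1 - \<epsilon>)" using m mpos eps by (simp add: field_simps)
      have "0 \<le> g R"
        using nonneg R(1) by simp
      then show "0 \<le> M + g R + 2 * C" using M C by simp
    qed (use mpos m0 in auto)
    finally show "(LINT x|?p. LINT y|?p. trunc_log M (2 * R + 1) x y) + (LINT x|?p. g (cmod x))
      \<le> (A + 2 * C) / (1 - \<epsilon>)\<^sup>2 - 2 * C + (M + g R + 2 * C) / ((1 - \<epsilon>) * real n)"
      by (simp add: b_def power_divide)
  qed
qed

text \<open>
  The discrete energy of configurations outside \<open>U\<close> is asymptotically at least the continuous one.
\<close>

lemma eventually_pair_energy_greater:
  fixes g :: "real \<Rightarrow> real" and A :: real
  assumes g: "mono_on {0..} g" "\<And>r. 0 \<le> r \<Longrightarrow> 0 \<le> g r" "continuous_on {0<..} g"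
    and growth: "((\<lambda>r. r * exp (- g r / 2)) \<longlongrightarrow> 0) at_top"
    and U: "open U" and A: "ereal A < hole_energy g U"
  shows "eventually (\<lambda>n. \<forall>z. (\<forall>i<n. z i \<notin> U) \<longrightarrow> inj_on z {..<n} \<longrightarrow>
    A * (real n)\<^sup>2 < pair_energy g n z) sequentially"
proof (rule ccontr)
  assume "\<not> ?thesis"
  then have bad: "\<exists>n\<ge>N. \<exists>z. (\<forall>i<n. z i \<notin> U) \<and> inj_on z {..<n} \<and> pair_energy g n z \<le> A * (real n)\<^sup>2" for N
    by (simp add: eventually_sequentially not_less)
  have "\<exists>n z. \<forall>k. k + 2 \<le> n k \<and> (\<forall>i<n k. z k i \<notin> U) \<and> inj_on (z k) {..<n k} \<and> pair_energy g (n k) (z k) \<le> A * (real (n k))\<^sup>2"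
    using bad[of "_ + 2"] by metis
  then obtain n z where nz: "\<And>k. k + 2 \<le> n k" "\<And>k i. i < n k \<Longrightarrow> z k i \<notin> U"
      "\<And>k. inj_on (z k) {..<n k}" "\<And>k. pair_energy g (n k) (z k) \<le> A * (real (n k))\<^sup>2"
    by metis
  obtain R0 where R0: "0 < R0" "\<And>r. R0 \<le> r \<Longrightarrow> 0 \<le> g r / 2 - ln (1 + r)"
    using weight_dominates_log[OF growth] by blast
  define C where "C = ln (1 + R0)"
  have C0: "0 \<le> C" using R0 by (simp add: C_def)
  have C: "- C \<le> g r / 2 - ln (1 + r)" if "0 \<le> r" for r
  proof (cases "R0 \<le> r")
    case True
    then show ?thesis using R0(2) C0 by fastforce
  next
    case False
    then have "ln (1 + r) \<le> C" unfolding C_def using that by (subst ln_le_cancel_iff) auto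
    then show ?thesis using g(2)[OF that] by simp
  qed
  obtain B where B: "A < B" "ereal B < hole_energy g U"
    using ereal_dense2[OF A] by (metis ereal_less(2) ereal_less_eq(3) less_ereal.simps(1) ereal_dense3 A)
  have "((\<lambda>\<epsilon>. (A + 2 * C) / (1 - \<epsilon>)\<^sup>2 - 2 * C) \<longlongrightarrow> (A + 2 * C) / (1 - 0)\<^sup>2 - 2 * C) (at_right 0)"
    by (intro tendsto_intros) auto
  then have "eventually (\<lambda>\<epsilon>. (A + 2 * C) / (1 - \<epsilon>)\<^sup>2 - 2 * C < B) (at_right 0)"
    using B(1) by (intro order_tendstoD(2)) auto
  moreover have "eventually (\<lambda>\<epsilon>. 0 < \<epsilon> \<and> \<epsilon> < (1::real)) (at_right 0)"
    by (rule eventually_at_rightI[of 0 1]) auto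
  ultimately have "eventually (\<lambda>\<epsilon>. (A + 2 * C) / (1 - \<epsilon>)\<^sup>2 - 2 * C < B \<and> 0 < \<epsilon> \<and> \<epsilon> < 1) (at_right 0)"
    by eventually_elim simp
  from eventually_happens'[OF trivial_limit_at_right_real this] obtain \<epsilon> where eps: "(A + 2 * C) / (1 - \<epsilon>)\<^sup>2 - 2 * C < B" "0 < \<epsilon>" "\<epsilon> < 1"
    by blast
  obtain R where R: "0 < R" "\<And>r. R \<le> r \<Longrightarrow> (A + 2 * C + 1) / \<epsilon> \<le> g r / 2 - ln (1 + r)"
    using weight_dominates_log[OF growth] by blast
  define E where "E p M = (LINT x|measure_pmf p. LINT y|measure_pmf p. trunc_log M (2 * R + 1) x y)
        + (LINT x|measure_pmf p. g (cmod x))" for p M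
  define K where "K = cball 0 R - U"
  have "\<exists>p. set_pmf p \<subseteq> K \<and> (\<forall>M\<ge>0. E p M \<le> B + (M + g R + 2 * C) / ((1 - \<epsilon>) * real (n k)))" for k
  proof -
    have n2: "2 \<le> n k" using nz(1)[of k] by simp
    obtain I where I: "I \<subseteq> {..<n k}" "I \<noteq> {}" "\<And>i. i \<in> I \<Longrightarrow> cmod (z k i) \<le> R"
      "\<And>M. 0 \<le> M \<Longrightarrow> E (map_pmf (z k) (pmf_of_set I)) M
        \<le> (A + 2 * C) / (1 - \<epsilon>)\<^sup>2 - 2 * C + (M + g R + 2 * C) / ((1 - \<epsilon>) * real (n k))"
      using low_energy_configuration[OF n2 nz(3,4) g(1,2) C0 C eps(2,3) R] unfolding E_def by metis
    have "finite I" using I(1) finite_subset by blast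
    then have "set_pmf (map_pmf (z k) (pmf_of_set I)) \<subseteq> K"
      using I nz(2)[of _ k] by (auto simp: K_def)
    then show ?thesis using I(4) eps(1) by (intro exI[of _ "map_pmf (z k) (pmf_of_set I)"]) fastforce
  qed
  then obtain p where p: "\<And>k. set_pmf (p k) \<subseteq> K"
    "\<And>k M. 0 \<le> M \<Longrightarrow> E (p k) M \<le> B + (M + g R + 2 * C) / ((1 - \<epsilon>) * real (n k))"
    by metis
  have K: "compact K" unfolding K_def by (intro compact_diff compact_cball U)
  have conv: "eventually (\<lambda>k. E (p k) M \<le> B + e) sequentially" if "0 \<le> M" "0 < e" for M e
  proof -
    have "(\<lambda>k. (M + g R + 2 * C) / (1 - \<epsilon>) * (1 / real k)) \<longlonglongrightarrow> (M + g R + 2 * C) / (1 - \<epsilon>) * 0"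
      by (intro tendsto_mult tendsto_const lim_1_over_n)
    then have "eventually (\<lambda>k. (M + g R + 2 * C) / (1 - \<epsilon>) * (1 / real k) < e) sequentially"
      using that by (intro order_tendstoD(2)) auto
    then show ?thesis
      using eventually_gt_at_top[of 0]
    proof eventually_elim
      case (elim k)
      have "0 \<le> M + g R + 2 * C" using that C0 g(2)[of R] R(1) by simp
      then have "(M + g R + 2 * C) / ((1 - \<epsilon>) * real (n k)) \<le> (M + g R + 2 * C) / ((1 - \<epsilon>) * real k)"
        using eps elim nz(1)[of k] by (intro divide_left_mono mult_left_mono) auto
      then show ?case using p(2)[OF that(1), of k] elim by simp
    qed
  qed
  obtain \<mu> where mu: "\<mu> \<in> compact_prob_measures K" "weighted_energy g \<mu> \<le> ereal B"
  proof (rule limit_measure_energy_le[OF K p(1) g R(1), where b = "2 * R + 1" and B = B])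
    show "cmod z \<le> R" if "z \<in> K" for z using that by (simp add: K_def)
  qed (use R(1) conv in \<open>simp_all add: E_def\<close>)
  have "\<mu> \<in> compact_prob_measures (- U)"
    using mu(1) by (auto simp: compact_prob_measures_def K_def)
  then have "hole_energy g U \<le> ereal B"
    unfolding hole_energy_def using mu(2) by (intro INF_lower2)
  with B(2) show False by simp
qed

section \<open>Hole probability\<close>

lemma gas_weight_measurable:
  assumes "mono_on {0..} g"
  shows "(\<lambda>z. gas_weight g n z) \<in> borel_measurable (\<Pi>\<^sub>M k\<in>{..<n}. (lborel :: complex measure))"
proof -
  note [measurable] = measurable_radial[OF assms]
  show ?thesis unfolding gas_weight_def
    by measurable
qed

lemma hole_prob_le:
  fixes g :: "real \<Rightarrow> real" and A :: real
  assumes mono: "mono_on {0..} g" and U: "open U"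
    and energy: "\<And>z. (\<forall>i<n. z i \<notin> U) \<Longrightarrow> inj_on z {..<n} \<Longrightarrow> A * (real n)\<^sup>2 \<le> pair_energy g n z"
    and c: "(\<integral>\<^sup>+ z. ennreal (exp (- g (cmod z))) \<partial>(lborel :: complex measure)) \<le> ennreal c" "0 < c"
  shows "hole_prob g n U \<le> ennreal (exp (- A * (real n)\<^sup>2 + real n * ln c)) / gas_partition g n"
proof -
  let ?P = "\<Pi>\<^sub>M k\<in>{..<n}. (lborel :: complex measure)"
  interpret product_sigma_finite "\<lambda>_::nat. lborel :: complex measure" ..
  note [measurable] = gas_weight_measurable[OF mono, of n] measurable_radial[OF mono]
  define S where "S = {z \<in> space ?P. \<forall>k<n. z k \<notin> U}"
  have [measurable]: "U \<in> sets borel" using U by simp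
  have "S = {z \<in> space ?P. \<forall>k\<in>{..<n}. z k \<notin> U}" by (auto simp: S_def)
  also have "\<dots> \<in> sets ?P" by measurable
  finally have S [measurable]: "S \<in> sets ?P" .
  have "hole_prob g n U = emeasure (gas_law g n) S"
    unfolding hole_prob_def S_def
    by (intro arg_cong[of _ _ "emeasure (gas_law g n)"]) (auto simp: gas_law_def point_count_def)
  also have "\<dots> = (\<integral>\<^sup>+ z. ennreal (gas_weight g n z) / gas_partition g n * indicator S z \<partial>?P)"
    unfolding gas_law_def by (rule emeasure_density) measurable
  also have "\<dots> = (\<integral>\<^sup>+ z. ennreal (gas_weight g n z) * indicator S z / gas_partition g n \<partial>?P)"
    by (intro nn_integral_cong) (simp add: indicator_def)
  also have "\<dots> = (\<integral>\<^sup>+ z. ennreal (gas_weight g n z) * indicator S z \<partial>?P) / gas_partition g n"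
    by (rule nn_integral_divide) measurable
  also have "\<dots> \<le> ennreal (exp (- A * (real n)\<^sup>2 + real n * ln c)) / gas_partition g n"
  proof (rule divide_right_mono_ennreal)
    have "(\<integral>\<^sup>+ z. ennreal (gas_weight g n z) * indicator S z \<partial>?P)
        \<le> (\<integral>\<^sup>+ z. ennreal (exp (- A * (real n)\<^sup>2)) * (\<Prod>k<n. ennreal (exp (- g (cmod (z k))))) \<partial>?P)"
    proof (rule nn_integral_mono)
      fix z :: "nat \<Rightarrow> complex"
      show "ennreal (gas_weight g n z) * indicator S z
          \<le> ennreal (exp (- A * (real n)\<^sup>2)) * (\<Prod>k<n. ennreal (exp (- g (cmod (z k)))))"
      proof (cases "z \<in> S \<and> inj_on z {..<n}")
        case True
        then have "A * (real n)\<^sup>2 \<le> pair_energy g n z" by (intro energy) (auto simp: S_def)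
        then have "gas_weight g n z \<le> exp (- A * (real n)\<^sup>2) * (\<Prod>k<n. exp (- g (cmod (z k))))"
          using True gas_weight_eq_exp_pair_energy[of z n g]
          by (auto intro!: mult_right_mono prod_nonneg)
        then have "ennreal (gas_weight g n z) \<le> ennreal (exp (- A * (real n)\<^sup>2) * (\<Prod>k<n. exp (- g (cmod (z k)))))"
          by (rule ennreal_leI)
        also have "\<dots> = ennreal (exp (- A * (real n)\<^sup>2)) * (\<Prod>k<n. ennreal (exp (- g (cmod (z k)))))"
          by (simp add: ennreal_mult prod_nonneg prod_ennreal)
        finally show ?thesis using True by simp
      next
        case False
        \<comment> \<open>Coinciding points carry no weight.\<close>
        have "gas_weight g n z = 0" if noninj: "\<not> inj_on z {..<n}"
        proof -
          obtain i j where "i < j" "j < n" "z i = z j"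
            using noninj unfolding inj_on_def by (metis lessThan_iff linorder_neqE_nat)
          then have "(\<Prod>j<n. \<Prod>i<j. (cmod (z i - z j))\<^sup>2) = 0"
            by (intro prod_zero) auto
          then show ?thesis unfolding gas_weight_def by simp
        qed
        with False show ?thesis by auto
      qed
    qed
    also have "\<dots> = ennreal (exp (- A * (real n)\<^sup>2)) * (\<integral>\<^sup>+ z. (\<Prod>k<n. ennreal (exp (- g (cmod (z k))))) \<partial>?P)"
      by (rule nn_integral_cmult) measurable
    also have "(\<integral>\<^sup>+ z. (\<Prod>k<n. ennreal (exp (- g (cmod (z k))))) \<partial>?P)
        = (\<Prod>k<n. \<integral>\<^sup>+ z. ennreal (exp (- g (cmod z))) \<partial>(lborel :: complex measure))"
      by (rule product_nn_integral_prod) auto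
    also have "\<dots> \<le> (\<Prod>k<n. ennreal c)" by (intro prod_mono_ennreal c)
    also have "\<dots> = ennreal (exp (real n * ln c))"
      using c by (simp add: ennreal_power exp_of_nat_mult)
    also have "ennreal (exp (- A * (real n)\<^sup>2)) * ennreal (exp (real n * ln c))
        = ennreal (exp (- A * (real n)\<^sup>2 + real n * ln c))"
      by (simp only: ennreal_mult[symmetric] exp_ge_zero exp_add)
    finally show "(\<integral>\<^sup>+ z. ennreal (gas_weight g n z) * indicator S z \<partial>?P)
        \<le> ennreal (exp (- A * (real n)\<^sup>2 + real n * ln c))"
      by (simp add: mult_left_mono)
  qed
  finally show ?thesis .
qed

lemma log_ennreal_le:
  assumes "x \<le> ennreal (exp t)" shows "log_ennreal x \<le> ereal t"
proof (cases x)
  case (real r)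
  then have "r \<le> exp t" using assms by simp
  then have "ln r \<le> t" if "0 < r" using that by (metis ln_exp ln_le_cancel_iff exp_gt_zero)
  then show ?thesis using real by (auto simp: log_ennreal_def)
qed (use assms in \<open>simp add: top_unique\<close>)

text \<open>
  The degenerate values are harmless: for \<open>Z = 0\<close> the right-hand side is \<open>\<infinity>\<close>, and for \<open>Z = \<infinity>\<close> the
  hypothesis forces \<open>x = 0\<close>.
\<close>

lemma log_ennreal_quotient_le:
  assumes "x \<le> ennreal (exp t) / Z" shows "log_ennreal x \<le> ereal t - log_ennreal Z"
proof (cases Z)
  case (real r)
  show ?thesis
  proof (cases "r = 0")
    case True
    then show ?thesis using real by (simp add: log_ennreal_def)
  next
    case False
    with real have r: "0 < r" by simp
    have "ennreal (exp t) / Z = ennreal (exp (t - ln r))"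
      using r real by (simp add: divide_ennreal exp_diff)
    with assms have "log_ennreal x \<le> ereal (t - ln r)" by (intro log_ennreal_le) simp
    also have "\<dots> = ereal t - log_ennreal Z"
      using r real by (simp add: log_ennreal_def)
    finally show ?thesis .
  qed
next
  case top
  then have "x = 0" using assms by (simp add: ennreal_divide_top)
  then show ?thesis by (simp add: log_ennreal_def)
qed

text \<open>
  If \<open>a\<close> or \<open>b\<close> is \<open>-\<infinity>\<close>, the hypothesis is void, but then \<open>- a - b = \<infinity>\<close> by the conventions of the
  extended reals.
\<close>

lemma ereal_le_neg_add_neg:
  fixes X a b :: ereal
  assumes le: "\<And>s t :: real. ereal s < a \<Longrightarrow> ereal t < b \<Longrightarrow> X \<le> ereal (- s - t)"
  shows "X \<le> - a - b"
proof (cases "a = -\<infinity> \<or> b = -\<infinity> \<or> X = -\<infinity>")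
  case False
  then obtain s0 t0 where st: "ereal s0 < a" "ereal t0 < b"
    by (metis ereal_dense2 ereal_infty_less_eq2(2) ereal_less_eq(2) less_le not_less)
  with le obtain x where x: "X = ereal x"
    using False by (cases X) force+
  have s: "s \<le> - x - t" if "ereal s < a" "ereal t < b" for s t
    using le[OF that] x by simp
  have "a \<noteq> \<infinity>" using s[of "- x - t0 + 1" t0] st by auto
  moreover have "b \<noteq> \<infinity>" using s[of s0 "- x - s0 + 1"] st by auto
  ultimately obtain a' b' where ab: "a = ereal a'" "b = ereal b'"
    using False by (cases a; cases b) auto
  have "a' + b' \<le> - x + e" if "0 < e" for e
    using s[of "a' - e / 2" "b' - e / 2"] that ab by simp
  then have "a' + b' \<le> - x" by (rule field_le_epsilon)
  then show ?thesis using ab x by simp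
qed auto

theorem theorem3p5:
  fixes g :: "real \<Rightarrow> real" and T :: real and U :: "complex set"
  assumes g_nonneg: "\<And>r. 0 \<le> r \<Longrightarrow> 0 \<le> g r"
    and g_mono: "mono_on {0..} g"
    and g_growth: "((\<lambda>r. r * exp (- g r / 2)) \<longlongrightarrow> 0) at_top"
    and g_diff: "\<And>r. 0 < r \<Longrightarrow> g field_differentiable at r"
    and g_diff2: "\<And>r. 0 < r \<Longrightarrow> deriv g field_differentiable at r"
    and rg'_lim: "((\<lambda>r. r * deriv g r) \<longlongrightarrow> 0) (at_right 0)"
    and rg'_mono: "mono_on {0<..} (\<lambda>r. r * deriv g r)"
    and g_moments: "\<And>k::nat. set_integrable lborel {0..} (\<lambda>r. r ^ (2 * k + 1) * exp (- g r))"
    and T_pos: "0 < T"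
    and T_eq: "T * deriv g T = 2"
    and U_open: "open U"
    and U_sub: "U \<subseteq> ball 0 T"
  shows "limsup (\<lambda>n. ereal (1 / (real n)\<^sup>2) * log_ennreal (hole_prob g n U))
      \<le> - hole_energy g U
        - liminf (\<lambda>n. ereal (1 / (real n)\<^sup>2) * log_ennreal (gas_partition g n))"
proof (rule ereal_le_neg_add_neg)
  fix A l :: real
  assume A: "ereal A < hole_energy g U"
    and l: "ereal l < liminf (\<lambda>n. ereal (1 / (real n)\<^sup>2) * log_ennreal (gas_partition g n))"
  have cont: "continuous_on {0<..} g"
    using g_diff by (intro continuous_at_imp_continuous_on ballI field_differentiable_imp_continuous_at) auto
  have "(\<integral>\<^sup>+ z. ennreal (exp (- g (cmod z))) \<partial>(lborel :: complex measure)) < \<infinity>"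
    using g_moments[of 1] by (intro nn_integral_radial_weight_finite g_mono g_nonneg) (simp_all add: eval_nat_numeral)
  then obtain c' where "(\<integral>\<^sup>+ z. ennreal (exp (- g (cmod z))) \<partial>(lborel :: complex measure)) = ennreal c'" "0 \<le> c'"
    by (cases "(\<integral>\<^sup>+ z. ennreal (exp (- g (cmod z))) \<partial>(lborel :: complex measure))") auto
  then obtain c where c: "(\<integral>\<^sup>+ z. ennreal (exp (- g (cmod z))) \<partial>(lborel :: complex measure)) \<le> ennreal c" "0 < c"
    using that[of "c' + 1"] by (auto intro: ennreal_leI)
  have "eventually (\<lambda>n. \<forall>z. (\<forall>i<n. z i \<notin> U) \<longrightarrow> inj_on z {..<n} \<longrightarrow>
      A * (real n)\<^sup>2 < pair_energy g n z) sequentially"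
    by (rule eventually_pair_energy_greater) (fact g_mono g_nonneg cont g_growth U_open A)+
  moreover have "eventually (\<lambda>n. ereal l < ereal (1 / (real n)\<^sup>2) * log_ennreal (gas_partition g n)) sequentially"
    by (rule less_LiminfD[OF l])
  ultimately have "eventually (\<lambda>n. ereal (1 / (real n)\<^sup>2) * log_ennreal (hole_prob g n U)
      \<le> ereal (- A + ln c * (1 / real n) - l)) sequentially"
    using eventually_gt_at_top[of 0]
  proof eventually_elim
    case (elim n)
    let ?Z = "log_ennreal (gas_partition g n)"
    have n: "0 < 1 / (real n)\<^sup>2" using elim by simp
    have "hole_prob g n U \<le> ennreal (exp (- A * (real n)\<^sup>2 + real n * ln c)) / gas_partition g n"
      using elim(1) by (intro hole_prob_le g_mono U_open c) (auto intro: less_imp_le)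
    then have "log_ennreal (hole_prob g n U) \<le> ereal (- A * (real n)\<^sup>2 + real n * ln c) - ?Z"
      by (rule log_ennreal_quotient_le)
    then have "ereal (1 / (real n)\<^sup>2) * log_ennreal (hole_prob g n U)
      \<le> ereal (1 / (real n)\<^sup>2) * (ereal (- A * (real n)\<^sup>2 + real n * ln c) - ?Z)"
      using n by (intro ereal_mult_left_mono) auto
    also have "\<dots> \<le> ereal (- A + ln c * (1 / real n) - l)"
    proof (cases ?Z)
      case (real y)
      then have "l \<le> y / (real n)\<^sup>2" using elim(2) by simp
      moreover have "1 / (real n)\<^sup>2 * (- A * (real n)\<^sup>2 + real n * ln c - y) = - A + ln c * (1 / real n) - y / (real n)\<^sup>2"
        using elim(3) by (simp add: field_simps power2_eq_square)
      ultimately show ?thesis using real by simp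
    next
      case PInf
      then show ?thesis using n by (simp add: ereal_mult_infty)
    next
      case MInf
      then show ?thesis using n elim(2) by (simp add: ereal_mult_infty)
    qed
    finally show ?case .
  qed
  then have "limsup (\<lambda>n. ereal (1 / (real n)\<^sup>2) * log_ennreal (hole_prob g n U))
      \<le> limsup (\<lambda>n. ereal (- A + ln c * (1 / real n) - l))"
    by (rule Limsup_mono)
  also have "(\<lambda>n. ereal (- A + ln c * (1 / real n) - l)) \<longlonglongrightarrow> ereal (- A + ln c * 0 - l)"
    by (intro tendsto_intros lim_1_over_n)
  then have "limsup (\<lambda>n. ereal (- A + ln c * (1 / real n) - l)) = ereal (- A - l)"
    using lim_imp_Limsup[of sequentially] by force
  finally show "limsup (\<lambda>n. ereal (1 / (real n)\<^sup>2) * log_ennreal (hole_prob g n U)) \<le> ereal (- A - l)" .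
qed

end
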